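(* Let $r,k$ be positive integers with $k\le (2r+1)/3$. Then every $(2r+1)$-regular graph with at most $2r-3(k-1)$ cut-edges has a $2k$-factor. Furthermore, both inequalities are sharp, in the following sense: (i) for all positive integers $r,k$ with $k\le (2r+1)/3$, there is a $(2r+1)$-regular graph with exactly $2r-3(k-1)+1$ cut-edges that has no $2k$-factor; (ii) for all positive integers $r,k$ with $k>(2r+1)/3$, there is a $(2r+1)$-regular graph with no cut-edges that has no $2k$-factor.
   Context: "Graph" means finite multigraph: loops and multiple edges are allowed, and a loop contributes $2$ to the degree of its vertex. Graphs need not be connected. A graph is $d$-regular if every vertex has degree $d$. An $\ell$-factor of a graph is an $\ell$-regular spanning subgraph. A cut-edge is an edge whose deletion increases the number of connected components. *)

theory Defs
  imports Complex_Main "HOL-Library.Uprod"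
begin

(* Edges have an identity of their own, so parallel edges are distinct edges with the same
   ends; a loop at v has the ends Upair v v. *)
record ('v, 'e) mgraph =
  verts :: "'v set"
  edges :: "'e set"
  ends :: "'e \<Rightarrow> 'v uprod"

definition finite_multigraph :: "('v, 'e) mgraph \<Rightarrow> bool" where
  "finite_multigraph G \<longleftrightarrow> finite (verts G) \<and> finite (edges G) \<and>
     (\<forall>e \<in> edges G. set_uprod (ends G e) \<subseteq> verts G)"

(* The second summand counts each loop at v once more, so that it contributes 2. *)
definition degree :: "('v, 'e) mgraph \<Rightarrow> 'v \<Rightarrow> nat" where
  "degree G v = card {e \<in> edges G. v \<in> set_uprod (ends G e)} +
                card {e \<in> edges G. ends G e = Upair v v}"

definition regular_graph :: "nat \<Rightarrow> ('v, 'e) mgraph \<Rightarrow> bool" where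
  "regular_graph d G \<longleftrightarrow> (\<forall>v \<in> verts G. degree G v = d)"

definition spanning_subgraph :: "('v, 'e) mgraph \<Rightarrow> ('v, 'e) mgraph \<Rightarrow> bool" where
  "spanning_subgraph H G \<longleftrightarrow> finite_multigraph H \<and> verts H = verts G \<and>
     edges H \<subseteq> edges G \<and> (\<forall>e \<in> edges H. ends H e = ends G e)"

definition is_factor :: "nat \<Rightarrow> ('v, 'e) mgraph \<Rightarrow> ('v, 'e) mgraph \<Rightarrow> bool" where
  "is_factor l H G \<longleftrightarrow> spanning_subgraph H G \<and> regular_graph l H"

definition has_factor :: "nat \<Rightarrow> ('v, 'e) mgraph \<Rightarrow> bool" where
  "has_factor l G \<longleftrightarrow> (\<exists>H. is_factor l H G)"

definition adj_rel :: "('v, 'e) mgraph \<Rightarrow> ('v \<times> 'v) set" where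
  "adj_rel G = {(u, v). \<exists>e \<in> edges G. ends G e = Upair u v}"

definition conn_rel :: "('v, 'e) mgraph \<Rightarrow> ('v \<times> 'v) set" where
  "conn_rel G = (adj_rel G)\<^sup>* \<inter> verts G \<times> verts G"

definition components_of_graph :: "('v, 'e) mgraph \<Rightarrow> 'v set set" where
  "components_of_graph G = verts G // conn_rel G"

definition delete_edge :: "('v, 'e) mgraph \<Rightarrow> 'e \<Rightarrow> ('v, 'e) mgraph" where
  "delete_edge G e = G\<lparr>edges := edges G - {e}\<rparr>"

definition cut_edges :: "('v, 'e) mgraph \<Rightarrow> 'e set" where
  "cut_edges G = {e \<in> edges G.
     card (components_of_graph (delete_edge G e)) > card (components_of_graph G)}"

end

theory Submission
  imports Defs "HOL-Library.Disjoint_Sets" "HOL-Library.Nat_Bijection"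
begin

text \<open>
  If a graph has no \<open>2 * k\<close>-factor, the factor theorem of Belck and Tutte provides disjoint vertex
  sets \<open>S\<close> and \<open>T\<close> such that so many pieces of the rest are joined to \<open>T\<close> by an odd number of edges
  that the demand of \<open>T\<close> cannot be met (\<open>factor_barrier\<close>).  In a \<open>(2 * r + 1)\<close>-regular graph a weighted
  count of the edges leaving the pieces shows that at least \<open>2 * r + 4 - 3 * k\<close> of the pieces are
  attached to everything else by a single edge, which is then a cut-edge
  (\<open>regular_graph_has_even_factor\<close>).

  The factor theorem is obtained from a graph in which perfect matchings correspond to
  \<open>l\<close>-factors.  Perfect matchings are controlled by the Tutte--Berge theorem, proved here
  by induction from Gallai's lemma, the core of which is an exchange of a single edge
  (\<open>gallai_transfer\<close>).  Choosing the Tutte--Berge barrier with as few vertices as possible forces it to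
  respect the structure of the auxiliary graph, and it translates back into \<open>S\<close> and \<open>T\<close>.

  Sharpness is witnessed by graphs made of a few hubs and many satellites carrying loops.  A
  satellite has an odd number of spokes, an even factor can use only an even number of them, and
  so every satellite wastes a spoke.  With one hub and satellites of one or three spokes the number of
  cut-edges is just above the bound; with three hubs joined to all satellites there is no cut-edge,
  and the waste is fatal as soon as \<open>3 * k > 2 * r + 1\<close>.
\<close>

section \<open>Maximum matchings and the Tutte--Berge barrier\<close>

definition simple_graph :: "'a set \<Rightarrow> 'a set set \<Rightarrow> bool" where
  "simple_graph V E \<longleftrightarrow> finite V \<and> (\<forall>e \<in> E. e \<subseteq> V \<and> card e = 2)"

definition matching :: "'a set set \<Rightarrow> 'a set set \<Rightarrow> bool" where
  "matching E M \<longleftrightarrow> M \<subseteq> E \<and> disjoint M"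

definition max_matching :: "'a set set \<Rightarrow> 'a set set \<Rightarrow> bool" where
  "max_matching E M \<longleftrightarrow> matching E M \<and> (\<forall>N. matching E N \<longrightarrow> card N \<le> card M)"

lemma simple_graph_finite:
  assumes "simple_graph V E" shows "finite V" "finite E"
  using assms by (auto simp: simple_graph_def intro: finite_subset[of E "Pow V"])

lemma matching_finite:
  assumes "simple_graph V E" "matching E M"
  shows "finite M" "\<Union>M \<subseteq> V" "finite (\<Union>M)"
proof -
  show "finite M"
    using assms simple_graph_finite(2) unfolding matching_def by (meson finite_subset)
  show s: "\<Union>M \<subseteq> V" using assms by (auto simp: simple_graph_def matching_def)
  show "finite (\<Union>M)" using s simple_graph_finite(1)[OF assms(1)] by (rule finite_subset)
qed

lemma matching_eqI:
  assumes "matching E M" "e \<in> M" "g \<in> M" "x \<in> e" "x \<in> g"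
  shows "e = g"
  using assms unfolding matching_def disjoint_def by (metis disjoint_iff)

lemma partition_on_eqI:
  assumes "partition_on A P" "K \<in> P" "L \<in> P" "x \<in> K" "x \<in> L"
  shows "K = L"
  using assms unfolding partition_on_def disjoint_def by (metis disjoint_iff)

lemma card_Union_matching:
  assumes "simple_graph V E" "matching E M"
  shows "card (\<Union>M) = 2 * card M"
proof -
  have "card (\<Union>M) = (\<Sum>e\<in>M. card e)"
    using assms by (intro card_Union_disjoint)
      (auto simp: simple_graph_def matching_def disjoint_def disjnt_def pairwise_def
        intro: finite_subset)
  also have "\<dots> = (\<Sum>e\<in>M. 2)"
    using assms by (intro sum.cong) (auto simp: simple_graph_def matching_def)
  finally show ?thesis by simp
qed

lemma edge_other_end:
  assumes "simple_graph V E" "e \<in> E" "x \<in> e"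
  obtains y where "e = {x, y}" "y \<noteq> x"
proof -
  have "card e = 2" using assms by (auto simp: simple_graph_def)
  then obtain a b where "e = {a, b}" "a \<noteq> b" by (meson card_2_iff)
  then show ?thesis using assms(3) that by (cases "x = a") (auto simp: insert_commute)
qed

lemma matching_insert:
  assumes "matching E M" "e \<in> E" "e \<inter> \<Union>M = {}"
  shows "matching E (insert e M)"
  using assms unfolding matching_def disjoint_def by blast

lemma max_matching_exists:
  assumes "simple_graph V E"
  obtains M where "max_matching E M"
proof -
  have "\<exists>M. matching E M \<and> (\<forall>N. matching E N \<longrightarrow> card N \<le> card M)"
    by (rule ex_has_greatest_nat[of _ "{}" _ "Suc (card E)"])
      (auto simp: matching_def disjoint_def less_Suc_eq_le intro: card_mono simple_graph_finite(2)[OF assms])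
  then show ?thesis using that unfolding max_matching_def by blast
qed

lemma max_matching_card:
  assumes "simple_graph V E" "max_matching E M" "max_matching E N"
  shows "card (\<Union>M) = card (\<Union>N)"
  using assms card_Union_matching[OF assms(1)] by (simp add: max_matching_def order_antisym)

lemma max_matching_meets_edge:
  assumes "simple_graph V E" "max_matching E M" "e \<in> E"
  shows "e \<inter> \<Union>M \<noteq> {}"
proof
  assume d: "e \<inter> \<Union>M = {}"
  have m: "matching E M" using assms(2) by (simp add: max_matching_def)
  have "e \<noteq> {}" using assms(1,3) by (auto simp: simple_graph_def)
  then have "e \<notin> M" using d by auto
  then have "card (insert e M) = Suc (card M)"
    using matching_finite(1)[OF assms(1) m] by simp
  moreover have "card (insert e M) \<le> card M"
    using assms(2) matching_insert[OF m assms(3) d] by (simp add: max_matching_def)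
  ultimately show False by simp
qed

text \<open>
  This is the transitivity step of Gallai's lemma: if no maximum matching misses both \<open>u\<close> and
  \<open>t\<close>, and none misses both \<open>t\<close> and \<open>v\<close>, then none misses both \<open>u\<close> and \<open>v\<close>.  Among the maximum
  matchings missing \<open>t\<close> take the \<open>N\<close> that shares most edges with the given \<open>M\<close>.  If \<open>N\<close> covers
  both \<open>u\<close> and \<open>v\<close>, which \<open>M\<close> misses, then by equality of sizes \<open>M\<close> covers two vertices that
  \<open>N\<close> misses, one of them an \<open>x \<noteq> t\<close>.  Exchanging the \<open>N\<close>-edge at the \<open>M\<close>-partner of \<open>x\<close> for the
  \<open>M\<close>-edge at \<open>x\<close> brings \<open>N\<close> closer to \<open>M\<close>.
\<close>

lemma gallai_transfer:
  assumes G: "simple_graph V E"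
    and M: "max_matching E M" and u: "u \<in> V - \<Union>M" and v: "v \<in> V - \<Union>M" and uv: "u \<noteq> v"
    and L: "max_matching E L" and t: "t \<notin> \<Union>L"
  shows "\<exists>N. max_matching E N \<and> t \<notin> \<Union>N \<and> (u \<notin> \<Union>N \<or> v \<notin> \<Union>N)"
proof (rule ccontr)
  assume "\<not> ?thesis"
  then have cov: "u \<in> \<Union>N \<and> v \<in> \<Union>N" if "max_matching E N" "t \<notin> \<Union>N" for N
    using that by blast
  have "\<exists>N. (max_matching E N \<and> t \<notin> \<Union>N) \<and>
      (\<forall>N'. max_matching E N' \<and> t \<notin> \<Union>N' \<longrightarrow> card (M \<inter> N') \<le> card (M \<inter> N))"
  proof (rule ex_has_greatest_nat[of _ L _ "Suc (card M)"])
    show "\<forall>N. max_matching E N \<and> t \<notin> \<Union>N \<longrightarrow> card (M \<inter> N) < Suc (card M)"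
      using matching_finite(1)[OF G] M by (auto simp: less_Suc_eq_le max_matching_def intro: card_mono)
  qed (use L t in auto)
  then obtain N where N: "max_matching E N" and tN: "t \<notin> \<Union>N"
    and best: "\<And>N'. max_matching E N' \<Longrightarrow> t \<notin> \<Union>N' \<Longrightarrow> card (M \<inter> N') \<le> card (M \<inter> N)"
    by blast
  have mM: "matching E M" and mN: "matching E N" using M N by (auto simp: max_matching_def)
  note fin = matching_finite(3)[OF G mM] matching_finite(3)[OF G mN]
  have uvN: "{u, v} \<subseteq> \<Union>N - \<Union>M" using cov[OF N tN] u v by blast
  have "2 \<le> card (\<Union>N - \<Union>M)"
    using card_mono[OF _ uvN] fin uv by simp
  also have "card (\<Union>N - \<Union>M) = card (\<Union>M - \<Union>N)"
    using fin max_matching_card[OF G M N]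
    by (intro order_antisym card_le_sym_Diff) auto
  finally have "\<not> \<Union>M - \<Union>N \<subseteq> {t}"
    using card_mono[of "{t}" "\<Union>M - \<Union>N"] by auto
  then obtain x where x: "x \<in> \<Union>M" "x \<notin> \<Union>N" "x \<noteq> t" by blast
  then obtain e where e: "e \<in> M" "x \<in> e" by blast
  then have eE: "e \<in> E" using mM by (auto simp: matching_def)
  obtain y where y: "e = {x, y}" "y \<noteq> x" using edge_other_end[OF G eE e(2)] .
  have "y \<in> \<Union>N" using max_matching_meets_edge[OF G N eE] y x(2) by auto
  then obtain g where g: "g \<in> N" "y \<in> g" by blast
  have xg: "x \<notin> g" using x(2) g by blast
  have eN: "e \<notin> N" using x(2) e(2) by blast
  have gM: "g \<notin> M" using matching_eqI[OF mM _ e(1), of g y] g xg e(2) y by auto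
  define N' where "N' = insert e (N - {g})"
  have "matching E (N - {g})" using mN unfolding matching_def disjoint_def by auto
  moreover have "e \<inter> \<Union>(N - {g}) = {}"
    using matching_eqI[OF mN g(1) _ g(2)] x(2) y(1) by auto
  ultimately have mN': "matching E N'" unfolding N'_def using eE by (intro matching_insert)
  have finN: "finite N" using matching_finite(1)[OF G mN] .
  have "card N' = Suc (card (N - {g}))" unfolding N'_def using eN finN by simp
  then have "card N' = card N" using card_Suc_Diff1[OF finN g(1)] by simp
  then have "max_matching E N'" using mN' N by (simp add: max_matching_def)
  moreover have "t \<notin> \<Union>N'"
    using tN \<open>y \<in> \<Union>N\<close> x(3) y(1) unfolding N'_def by auto
  ultimately have "card (M \<inter> N') \<le> card (M \<inter> N)" by (rule best)
  moreover have "M \<inter> N' = insert e (M \<inter> N)" unfolding N'_def using e(1) gM by auto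
  ultimately show False using eN finN by simp
qed

text \<open>
  The blocks of \<open>P\<close> are unions of connected components of the graph without \<open>X\<close>.  They need not be
  connected: the counting arguments use only that no edge joins two blocks, and merging blocks is
  then a harmless operation.
\<close>

definition separates :: "'a set \<Rightarrow> 'a set set \<Rightarrow> 'a set \<Rightarrow> 'a set set \<Rightarrow> bool" where
  "separates V E X P \<longleftrightarrow> X \<subseteq> V \<and> partition_on (V - X) P \<and>
     (\<forall>e \<in> E. e \<inter> X = {} \<longrightarrow> (\<exists>K \<in> P. e \<subseteq> K))"

definition odd_blocks :: "'a set set \<Rightarrow> 'a set set" where
  "odd_blocks P = {K \<in> P. odd (card K)}"

text \<open>
  If every vertex is missed by some maximum matching, Gallai's lemma makes ``no maximum matching
  misses both'' an equivalence relation.  Adjacent vertices are equivalent, so its classes are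
  unions of components; a maximum matching misses at most one vertex of each class and pairs the
  others within the class, so each class with a missed vertex is odd.
\<close>

lemma tutte_berge_all_missed:
  assumes G: "simple_graph V E"
    and missed: "\<And>v. v \<in> V \<Longrightarrow> \<exists>M. max_matching E M \<and> v \<notin> \<Union>M"
    and M: "max_matching E M"
  shows "\<exists>P. separates V E {} P \<and> card (V - \<Union>M) \<le> card (odd_blocks P)"
proof -
  define R where "R = {(u, v). u \<in> V \<and> v \<in> V \<and>
    (u \<noteq> v \<longrightarrow> (\<forall>N. max_matching E N \<longrightarrow> u \<in> \<Union>N \<or> v \<in> \<Union>N))}"
  have eqR: "equiv V R"
  proof (rule equivI)
    show "R \<subseteq> V \<times> V" "refl_on V R" "sym R" by (auto simp: R_def refl_on_def sym_def)
    show "trans R"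
    proof (rule transI)
      fix u t v assume ut: "(u, t) \<in> R" and tv: "(t, v) \<in> R"
      show "(u, v) \<in> R"
      proof (rule ccontr)
        assume "(u, v) \<notin> R"
        then obtain N where N: "max_matching E N" "u \<in> V - \<Union>N" "v \<in> V - \<Union>N" "u \<noteq> v"
          using ut tv by (auto simp: R_def)
        obtain L where L: "max_matching E L" "t \<notin> \<Union>L" using missed[of t] ut unfolding R_def by blast
        obtain N' where N': "max_matching E N'" "t \<notin> \<Union>N'" "u \<notin> \<Union>N' \<or> v \<notin> \<Union>N'"
          using gallai_transfer[OF G N L] by blast
        have "u \<noteq> t" "v \<noteq> t" using \<open>(u, v) \<notin> R\<close> ut tv by auto
        then show False using ut tv N' unfolding R_def by blast
      qed
    qed
  qed
  define P where "P = V // R"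
  have part: "partition_on V P" unfolding P_def by (rule partition_on_quotient[OF eqR])
  have block: "\<exists>K \<in> P. e \<subseteq> K" if e: "e \<in> E" for e
  proof -
    obtain x y where xy: "e = {x, y}" "x \<noteq> y"
      using G e by (metis card_2_iff simple_graph_def)
    have "(x, y) \<in> R"
      using max_matching_meets_edge[OF G _ e] xy G e by (auto simp: R_def simple_graph_def)
    then have "e \<subseteq> R `` {x}" using xy equiv_class_self[OF eqR, of x] by (auto simp: R_def)
    moreover have "R `` {x} \<in> P" unfolding P_def
      using \<open>(x, y) \<in> R\<close> by (intro quotientI) (auto simp: R_def)
    ultimately show ?thesis by blast
  qed
  have mM: "matching E M" using M by (simp add: max_matching_def)
  have odd_class: "R `` {v} \<in> odd_blocks P" if v: "v \<in> V - \<Union>M" for v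
  proof -
    let ?K = "R `` {v}"
    have KP: "?K \<in> P" unfolding P_def using v by (intro quotientI) auto
    have vK: "v \<in> ?K" using v equiv_class_self[OF eqR] by auto
    have sub: "?K - \<Union>M \<subseteq> {v}" using v M by (auto simp: R_def)
    have inside: "e \<subseteq> ?K" if e: "e \<in> M" "e \<inter> ?K \<noteq> {}" for e
    proof -
      have "e \<in> E" using e(1) mM by (auto simp: matching_def)
      then obtain K where K: "K \<in> P" "e \<subseteq> K" using block by blast
      then have "K = ?K" using partition_on_eqI[OF part K(1) KP] e(2) by blast
      then show ?thesis using K by simp
    qed
    have "x \<in> \<Union>{e \<in> M. e \<subseteq> ?K}" if x: "x \<in> ?K" "x \<noteq> v" for x
    proof -
      obtain e where "e \<in> M" "x \<in> e" using sub x by blast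
      then show ?thesis using inside[of e] x(1) by auto
    qed
    then have K: "?K = insert v (\<Union>{e \<in> M. e \<subseteq> ?K})"
      using vK by auto
    have mm: "matching E {e \<in> M. e \<subseteq> ?K}"
      using mM by (auto simp: matching_def disjoint_def)
    have "card ?K = Suc (2 * card {e \<in> M. e \<subseteq> ?K})"
      using v matching_finite(3)[OF G mm] card_Union_matching[OF G mm] by (subst K) auto
    then show ?thesis using KP by (simp add: odd_blocks_def)
  qed
  have "inj_on (\<lambda>v. R `` {v}) (V - \<Union>M)"
  proof (rule inj_onI)
    fix u v assume uv: "u \<in> V - \<Union>M" "v \<in> V - \<Union>M" "R `` {u} = R `` {v}"
    then have "(u, v) \<in> R" using eq_equiv_class[OF _ eqR] by blast
    then show "u = v" using uv M by (auto simp: R_def)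
  qed
  moreover have "finite (odd_blocks P)"
    using finite_elements[OF simple_graph_finite(1)[OF G] part]
    by (simp add: odd_blocks_def)
  ultimately have "card (V - \<Union>M) \<le> card (odd_blocks P)"
    using odd_class by (intro card_inj_on_le) auto
  then show ?thesis using part block by (auto simp: separates_def)
qed

text \<open>
  Induction on the number of vertices.  A vertex \<open>a\<close> covered by every maximum matching can be put
  into \<open>X\<close>: deleting it lowers the matching number, so the number of missed vertices goes up by at
  least one, which pays for \<open>a\<close>.  If there is no such vertex, \<open>X\<close> can be empty.
\<close>

theorem tutte_berge:
  assumes "simple_graph V E" "max_matching E M"
  shows "\<exists>X P. separates V E X P \<and> card X + card (V - \<Union>M) \<le> card (odd_blocks P)"
  using assms
proof (induction "card V" arbitrary: V E M rule: less_induct)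
  case less
  note G = less.prems(1) and M = less.prems(2)
  have mM: "matching E M" using M by (simp add: max_matching_def)
  show ?case
  proof (cases "\<forall>v \<in> V. \<exists>M. max_matching E M \<and> v \<notin> \<Union>M")
    case True
    then have "\<exists>P. separates V E {} P \<and> card (V - \<Union>M) \<le> card (odd_blocks P)"
      by (intro tutte_berge_all_missed[OF G _ M]) blast
    then show ?thesis by (metis (no_types) add_0 card.empty)
  next
    case False
    then obtain a where a: "a \<in> V" and cov: "\<And>N. max_matching E N \<Longrightarrow> a \<in> \<Union>N" by blast
    define E' where "E' = {e \<in> E. a \<notin> e}"
    have G': "simple_graph (V - {a}) E'" using G by (auto simp: E'_def simple_graph_def)
    obtain N where N: "max_matching E' N" using max_matching_exists[OF G'] .
    have mN': "matching E' N" using N by (simp add: max_matching_def)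
    then have mN: "matching E N" by (auto simp: matching_def E'_def)
    have aN: "a \<notin> \<Union>N" using mN' by (auto simp: matching_def E'_def)
    have "card N < card M"
    proof (rule ccontr)
      assume "\<not> card N < card M"
      then have "max_matching E N" using mN M by (force simp: max_matching_def)
      then show False using cov aN by blast
    qed
    then have le: "card (\<Union>N) + 2 \<le> card (\<Union>M)"
      using card_Union_matching[OF G mM] card_Union_matching[OF G mN] by simp
    note fV = simple_graph_finite(1)[OF G]
    have "card (V - {a}) < card V" using a fV by (meson card_Diff1_less)
    from less.hyps[OF this G' N] obtain X P where
      XP: "separates (V - {a}) E' X P"
        "card X + card (V - {a} - \<Union>N) \<le> card (odd_blocks P)" by blast
    have X: "X \<subseteq> V - {a}" using XP(1) by (simp add: separates_def)
    have "separates V E (insert a X) P"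
    proof -
      have "V - insert a X = V - {a} - X" by blast
      then show ?thesis using XP(1) a by (auto simp: separates_def E'_def)
    qed
    moreover have "card (insert a X) + card (V - \<Union>M) \<le> card (odd_blocks P)"
    proof -
      have "a \<notin> X" "finite X" using X fV finite_subset by auto
      then have "card (insert a X) = Suc (card X)" by simp
      moreover have "card (V - {a} - \<Union>N) = card V - card (\<Union>N) - 1"
      proof -
        have "V - {a} - \<Union>N = V - \<Union>N - {a}" by blast
        then show ?thesis using a aN fV matching_finite[OF G mN]
          by (simp add: card_Diff_subset)
      qed
      moreover have "card (V - \<Union>M) = card V - card (\<Union>M)"
        using matching_finite[OF G mM] by (simp add: card_Diff_subset)
      moreover have "card (\<Union>M) \<le> card V"
        using matching_finite[OF G mM] fV by (simp add: card_mono)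
      ultimately show ?thesis using XP(2) le by linarith
    qed
    ultimately show ?thesis by blast
  qed
qed

text \<open>
  The number of missed vertices has the parity of \<open>card V\<close>, so without a perfect matching it is at
  least 2.
\<close>

lemma tutte_barrier:
  assumes G: "simple_graph V E" and ev: "even (card V)"
    and no: "\<And>M. matching E M \<Longrightarrow> \<Union>M \<noteq> V"
  shows "\<exists>X P. separates V E X P \<and> card X + 2 \<le> card (odd_blocks P)"
proof -
  obtain M where M: "max_matching E M" using max_matching_exists[OF G] .
  have mM: "matching E M" using M by (simp add: max_matching_def)
  have "card (V - \<Union>M) = card V - 2 * card M"
    using matching_finite[OF G mM] card_Union_matching[OF G mM] by (simp add: card_Diff_subset)
  then have "even (card (V - \<Union>M))" using ev by simp
  moreover have "card (V - \<Union>M) \<noteq> 0"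
    using no[OF mM] matching_finite[OF G mM] simple_graph_finite(1)[OF G] by auto
  ultimately have "2 \<le> card (V - \<Union>M)" by (meson dvd_imp_le neq0_conv)
  moreover obtain X P where "separates V E X P" "card X + card (V - \<Union>M) \<le> card (odd_blocks P)"
    using tutte_berge[OF G M] by blast
  ultimately show ?thesis by (intro exI[of _ X] exI[of _ P]) simp
qed

definition odd_neighbours :: "'a set set \<Rightarrow> 'a set set \<Rightarrow> 'a \<Rightarrow> 'a set set" where
  "odd_neighbours E P x = {K \<in> odd_blocks P. \<exists>y \<in> K. {x, y} \<in> E}"

text \<open>
  Moving \<open>x\<close> out of \<open>X\<close> merges all blocks adjacent to \<open>x\<close> into one.  If at most two of these are
  odd, then at most one odd block is lost: with two, the merged block is odd again.
\<close>

lemma barrier_remove_vertex: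
  assumes G: "simple_graph V E" and XP: "separates V E X P" and x: "x \<in> X"
    and few: "card (odd_neighbours E P x) \<le> 2"
  shows "\<exists>P'. separates V E (X - {x}) P' \<and> card (odd_blocks P) \<le> card (odd_blocks P') + 1"
proof -
  have part: "partition_on (V - X) P" and XV: "X \<subseteq> V" using XP by (auto simp: separates_def)
  have finP: "finite P"
    using finite_elements[OF _ part] simple_graph_finite(1)[OF G] by simp
  have finV: "finite V" using simple_graph_finite(1)[OF G] .
  define A where "A = {K \<in> P. \<exists>y \<in> K. {x, y} \<in> E}"
  define B where "B = insert x (\<Union>A)"
  define P' where "P' = insert B (P - A)"
  have UP: "\<Union>P = V - X" using part by (simp add: partition_on_def)
  have xP: "x \<notin> \<Union>P" using x UP by simp
  have BP: "B \<notin> P - A" using xP by (auto simp: B_def)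
  have sep: "separates V E (X - {x}) P'"
    unfolding separates_def
  proof (intro conjI ballI impI)
    show "X - {x} \<subseteq> V" using XV by auto
    show "partition_on (V - (X - {x})) P'"
    proof (rule partition_onI)
      show "\<Union>P' = V - (X - {x})"
      proof -
        have "\<Union>P' = insert x (\<Union>P)" by (auto simp: P'_def B_def A_def)
        then show ?thesis using UP x XV by auto
      qed
      show "{} \<notin> P'"
        using part by (auto simp: P'_def B_def partition_on_def)
      have dj: "disjnt K B" if "K \<in> P - A" for K
        using that xP partition_on_eqI[OF part, of K] unfolding B_def A_def disjnt_def by blast
      have dj2: "disjnt K L" if "K \<in> P" "L \<in> P" "K \<noteq> L" for K L
        using that partition_on_eqI[OF part, of K L] unfolding disjnt_def by blast
      show "disjnt p q" if "p \<in> P'" "q \<in> P'" "p \<noteq> q" for p q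
        using that dj dj2 unfolding P'_def by (auto simp: disjnt_sym)
    qed
  next
    fix e assume e: "e \<in> E" "e \<inter> (X - {x}) = {}"
    show "\<exists>K\<in>P'. e \<subseteq> K"
    proof (cases "x \<in> e")
      case True
      obtain y where y: "e = {x, y}" "y \<noteq> x" using edge_other_end[OF G e(1) True] .
      have "y \<in> V - X" using G e y x by (auto simp: simple_graph_def)
      then obtain K where "K \<in> P" "y \<in> K" using UP by blast
      then have "y \<in> \<Union>A" using e(1) y by (auto simp: A_def)
      then show ?thesis using y by (auto simp: P'_def B_def)
    next
      case False
      then obtain K where "K \<in> P" "e \<subseteq> K" using XP e unfolding separates_def by blast
      then show ?thesis by (cases "K \<in> A") (auto simp: P'_def B_def)
    qed
  qed
  define a where "a = card (odd_neighbours E P x)"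
  have on: "odd_neighbours E P x = {K \<in> A. odd (card K)}"
    by (auto simp: odd_neighbours_def A_def odd_blocks_def)
  have finK: "finite K" if "K \<in> P" for K
    using that UP finV by (metis Union_upper finite_Diff finite_subset)
  have "card (\<Union>A) = (\<Sum>K\<in>A. card K)"
    using part finK by (intro card_Union_disjoint)
      (auto simp: A_def partition_on_def disjoint_def disjnt_def pairwise_def)
  moreover have finA: "finite A" using finP by (simp add: A_def)
  ultimately have "odd (card (\<Union>A)) \<longleftrightarrow> odd a"
    using even_sum_iff[of A card] by (simp add: a_def on)
  moreover have "card B = Suc (card (\<Union>A))"
    unfolding B_def using finA finK xP by (subst card_insert_disjoint) (auto simp: A_def)
  ultimately have Bodd: "odd (card B) \<longleftrightarrow> even a" by simp
  have split: "odd_blocks P = odd_blocks (P - A) \<union> odd_neighbours E P x"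
    unfolding on by (auto simp: odd_blocks_def A_def)
  have c1: "card (odd_blocks P) = card (odd_blocks (P - A)) + a"
    unfolding split a_def using finP finA by (subst card_Un_disjoint)
      (auto simp: odd_blocks_def on)
  have c2: "card (odd_blocks P') = card (odd_blocks (P - A)) + (if even a then 1 else 0)"
  proof (cases "even a")
    case True
    then have "odd_blocks P' = insert B (odd_blocks (P - A))"
      using Bodd by (auto simp: odd_blocks_def P'_def)
    moreover have "B \<notin> odd_blocks (P - A)" using BP by (simp add: odd_blocks_def)
    ultimately show ?thesis using True finP by (simp add: odd_blocks_def)
  next
    case False
    then have "odd_blocks P' = odd_blocks (P - A)"
      using Bodd by (auto simp: odd_blocks_def P'_def)
    then show ?thesis using False by simp
  qed
  have "a = 0 \<or> a = 1 \<or> a = 2" using few unfolding a_def by linarith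
  then have "card (odd_blocks P) \<le> card (odd_blocks P') + 1" using c1 c2 by auto
  then show ?thesis using sep by blast
qed

text \<open>
  In a barrier with the fewest vertices every vertex is adjacent to three odd blocks, since otherwise
  it could be moved out.  This condition forces the barrier of the gadget graph below to
  treat all copies of a vertex, and all ports of a vertex, alike.
\<close>

lemma tutte_barrier_minimal:
  assumes G: "simple_graph V E" and ev: "even (card V)"
    and no: "\<And>M. matching E M \<Longrightarrow> \<Union>M \<noteq> V"
  obtains X P where "separates V E X P" "card X + 2 \<le> card (odd_blocks P)"
    "\<And>x. x \<in> X \<Longrightarrow> 3 \<le> card (odd_neighbours E P x)"
proof -
  let ?b = "\<lambda>XP. separates V E (fst XP) (snd XP) \<and> card (fst XP) + 2 \<le> card (odd_blocks (snd XP))"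
  obtain X0 P0 where "?b (X0, P0)" using tutte_barrier[OF G ev no] by auto
  from ex_has_least_nat[of ?b, OF this, of "card \<circ> fst"]
  obtain X P where XP: "separates V E X P" "card X + 2 \<le> card (odd_blocks P)"
    and least: "\<And>Y Q. separates V E Y Q \<Longrightarrow> card Y + 2 \<le> card (odd_blocks Q) \<Longrightarrow> card X \<le> card Y"
    by auto
  have "3 \<le> card (odd_neighbours E P x)" if x: "x \<in> X" for x
  proof (rule ccontr)
    assume "\<not> ?thesis"
    then have "card (odd_neighbours E P x) \<le> 2" by simp
    then obtain P' where P': "separates V E (X - {x}) P'"
      "card (odd_blocks P) \<le> card (odd_blocks P') + 1"
      using barrier_remove_vertex[OF G XP(1) x] by blast
    have "finite X" using XP(1) simple_graph_finite(1)[OF G] finite_subset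
      by (auto simp: separates_def)
    then have "Suc (card (X - {x})) = card X" using x by (rule card_Suc_Diff1)
    moreover have "card X \<le> card (X - {x})"
      using calculation XP(2) P'(2) by (intro least[OF P'(1)]) linarith
    ultimately show False by linarith
  qed
  then show ?thesis using that[OF XP] by simp
qed

section \<open>Half-edges\<close>

text \<open>
  The two half-edges \<open>(e, False)\<close> and \<open>(e, True)\<close> of an edge \<open>e\<close> are told apart even when \<open>e\<close> is a
  loop.  Counting half-edges instead of edges makes a loop contribute 2 to its vertex without any
  case distinction.  Which end of \<open>e\<close> is the first one is an arbitrary choice.
\<close>

definition vertex_at :: "('v, 'e) mgraph \<Rightarrow> 'e \<times> bool \<Rightarrow> 'v" where
  "vertex_at G h =
     (let p = (SOME p. ends G (fst h) = Upair (fst p) (snd p)) in if snd h then snd p else fst p)"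

definition half_edges :: "('v, 'e) mgraph \<Rightarrow> ('e \<times> bool) set" where
  "half_edges G = edges G \<times> UNIV"

definition mate :: "'e \<times> bool \<Rightarrow> 'e \<times> bool" where
  "mate h = (fst h, \<not> snd h)"

text \<open>
  For disjoint sets this is the number of edges between \<open>A\<close> and \<open>B\<close>; an edge with both ends in
  \<open>A \<inter> B\<close> is counted twice.
\<close>

definition cross :: "('v, 'e) mgraph \<Rightarrow> 'v set \<Rightarrow> 'v set \<Rightarrow> nat" where
  "cross G A B = card {h \<in> half_edges G. vertex_at G h \<in> A \<and> vertex_at G (mate h) \<in> B}"

lemma mate_simps [simp]:
  "mate (mate h) = h" "mate h \<noteq> h" "h \<noteq> mate h" "fst (mate h) = fst h"
  "mate h \<in> half_edges G \<longleftrightarrow> h \<in> half_edges G"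
  by (cases h; auto simp: mate_def half_edges_def)+

lemma mate_eq_iff [simp]: "mate h = mate h' \<longleftrightarrow> h = h'"
  by (metis mate_simps(1))

lemma half_edges_of_same_edge: "fst h = fst h' \<Longrightarrow> h = h' \<or> h = mate h'"
  by (cases h; cases h') (auto simp: mate_def)

lemma ends_vertex_at:
  "ends G e = Upair (vertex_at G (e, False)) (vertex_at G (e, True))"
proof -
  obtain a b where "ends G e = Upair a b" by (metis uprod_exhaust)
  then have "\<exists>p. ends G e = Upair (fst p) (snd p)" by (intro exI[of _ "(a, b)"]) simp
  from someI_ex[OF this] show ?thesis by (simp add: vertex_at_def Let_def)
qed

lemma ends_half_edge: "ends G (fst h) = Upair (vertex_at G h) (vertex_at G (mate h))"
  using ends_vertex_at[of G "fst h"]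
  by (cases h; cases "snd h") (auto simp: mate_def Upair_inject)

lemma finite_half_edges: "finite_multigraph G \<Longrightarrow> finite (half_edges G)"
  by (simp add: finite_multigraph_def half_edges_def)

lemma vertex_at_in_verts:
  assumes "finite_multigraph G" "h \<in> half_edges G"
  shows "vertex_at G h \<in> verts G"
  using assms ends_half_edge[of G h] by (auto simp: finite_multigraph_def half_edges_def)

lemma degree_half_edges:
  assumes "finite (edges G)"
  shows "degree G v = card {h \<in> half_edges G. vertex_at G h = v}"
proof -
  define A where "A b = {e \<in> edges G. vertex_at G (e, b) = v}" for b
  have fin: "finite (A b)" for b using assms by (simp add: A_def)
  have "{h \<in> half_edges G. vertex_at G h = v} = (\<lambda>e. (e, False)) ` A False \<union> (\<lambda>e. (e, True)) ` A True"
    by (auto simp: half_edges_def A_def image_iff) (metis (full_types))+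
  then have "card {h \<in> half_edges G. vertex_at G h = v} = card (A False) + card (A True)"
    using fin[of True] fin[of False] by (simp add: card_Un_disjoint card_image inj_on_def disjoint_iff image_iff)
  also have "\<dots> = card (A False \<union> A True) + card (A False \<inter> A True)"
    by (rule card_Un_Int[OF fin fin])
  also have "A False \<union> A True = {e \<in> edges G. v \<in> set_uprod (ends G e)}"
    by (auto simp: A_def ends_vertex_at)
  also have "A False \<inter> A True = {e \<in> edges G. ends G e = Upair v v}"
    by (auto simp: A_def ends_vertex_at Upair_inject)
  finally show ?thesis by (simp add: degree_def)
qed

section \<open>Factors as perfect matchings\<close>

text \<open>
  The gadget graph turns \<open>l\<close>-factors into perfect matchings.  A vertex \<open>v\<close> is replaced by \<open>l\<close>
  copies \<open>Inl (v, i)\<close>, an edge by a path through two ports \<open>Inr h\<close>, one for each half-edge \<open>h\<close>; the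
  port \<open>h\<close> is joined to its mate and to all copies of its vertex.  In a perfect matching the
  two ports of an edge are either matched to each other (the edge is left out) or both matched to
  copies (the edge is taken), and the \<open>l\<close> copies of \<open>v\<close> use up exactly \<open>l\<close> half-edges at \<open>v\<close>.
\<close>

definition gadget_verts :: "('v, 'e) mgraph \<Rightarrow> nat \<Rightarrow> ('v \<times> nat + 'e \<times> bool) set" where
  "gadget_verts G l = Inl ` (verts G \<times> {..<l}) \<union> Inr ` half_edges G"

definition gadget_edges :: "('v, 'e) mgraph \<Rightarrow> nat \<Rightarrow> ('v \<times> nat + 'e \<times> bool) set set" where
  "gadget_edges G l = {{Inr h, Inr (mate h)} | h. h \<in> half_edges G} \<union>
     {{Inr h, Inl (vertex_at G h, i)} | h i. h \<in> half_edges G \<and> i < l}"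

lemma gadget_simple_graph:
  assumes "finite_multigraph G"
  shows "simple_graph (gadget_verts G l) (gadget_edges G l)"
  using assms finite_half_edges[OF assms] vertex_at_in_verts[OF assms]
  by (auto simp: simple_graph_def gadget_verts_def gadget_edges_def finite_multigraph_def)

lemma gadget_card_verts:
  assumes "finite_multigraph G"
  shows "card (gadget_verts G l) = card (verts G) * l + 2 * card (edges G)"
proof -
  have "card (gadget_verts G l) =
      card (Inl ` (verts G \<times> {..<l}) :: ('a \<times> nat + 'b \<times> bool) set) +
      card (Inr ` half_edges G :: ('a \<times> nat + 'b \<times> bool) set)"
    unfolding gadget_verts_def using assms finite_half_edges[OF assms]
    by (intro card_Un_disjoint) (auto simp: finite_multigraph_def)
  then show ?thesis by (simp add: card_image half_edges_def card_cartesian_product)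
qed

lemma gadget_port_edge:
  "{Inr h, y} \<in> gadget_edges G l \<longleftrightarrow>
     h \<in> half_edges G \<and> (y = Inr (mate h) \<or> (\<exists>i<l. y = Inl (vertex_at G h, i)))"
  unfolding gadget_edges_def
  by (auto simp: doubleton_eq_iff simp del: split_paired_Ex split_paired_All)

lemma gadget_copy_edge:
  "{Inl (v, i), y} \<in> gadget_edges G l \<longleftrightarrow>
     i < l \<and> (\<exists>h \<in> half_edges G. vertex_at G h = v \<and> y = Inr h)"
  unfolding gadget_edges_def by (auto simp: doubleton_eq_iff)

lemma has_factor_if_perfect_matching:
  assumes G: "finite_multigraph G"
    and M: "matching (gadget_edges G l) M" and perf: "\<Union>M = gadget_verts G l"
  shows "has_factor l G"
proof -
  define F where "F = {e \<in> edges G. {Inr (e, False), Inr (e, True)} \<notin> M}"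
  define H where "H = G\<lparr>edges := F\<rparr>"
  have sub: "spanning_subgraph H G"
    using G by (auto simp: spanning_subgraph_def finite_multigraph_def H_def F_def)
  have at: "vertex_at H = vertex_at G" by (rule ext) (simp add: vertex_at_def H_def)
  have HE: "half_edges H = {h \<in> half_edges G. {Inr h, Inr (mate h)} \<notin> M}"
    by (auto simp: half_edges_def H_def F_def mate_def insert_commute)
      (metis (full_types) insert_commute)+
  have edgeE: "e \<in> gadget_edges G l" if "e \<in> M" for e
    using that M by (auto simp: matching_def)
  have "degree H v = l" if v: "v \<in> verts G" for v
  proof -
    define A where "A = {h \<in> half_edges H. vertex_at G h = v}"
    define f where "f h = (SOME i. {Inr h, Inl (v, i)} \<in> M)" for h
    have f: "{Inr h, Inl (v, f h)} \<in> M \<and> f h < l" if h: "h \<in> A" for h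
    proof -
      have hG: "h \<in> half_edges G" "vertex_at G h = v" "{Inr h, Inr (mate h)} \<notin> M"
        using h by (auto simp: A_def HE)
      then have "Inr h \<in> \<Union>M" by (simp add: perf gadget_verts_def)
      then obtain e where e: "e \<in> M" "Inr h \<in> e" by blast
      obtain y where y: "e = {Inr h, y}"
        using edge_other_end[OF gadget_simple_graph[OF G] edgeE[OF e(1)] e(2)] .
      then have "\<exists>i. {Inr h, Inl (v, i)} \<in> M"
        using edgeE[OF e(1)] e(1) hG by (auto simp: gadget_port_edge)
      then have "{Inr h, Inl (v, f h)} \<in> M" unfolding f_def by (rule someI_ex)
      then show ?thesis using edgeE[of "{Inr h, Inl (v, f h)}"] by (simp add: gadget_port_edge)
    qed
    have "bij_betw f A {..<l}"
    proof (rule bij_betw_imageI)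
      show "inj_on f A"
      proof (rule inj_onI)
        fix h h' assume h: "h \<in> A" "h' \<in> A" "f h = f h'"
        have "{Inr h, Inl (v, f h)} = {Inr h', Inl (v, f h')}"
          using f[OF h(1)] f[OF h(2)] h(3)
          by (intro matching_eqI[OF M, where x = "Inl (v, f h)"]) simp_all
        then show "h = h'" by (auto simp: doubleton_eq_iff)
      qed
      have "i \<in> f ` A" if i: "i < l" for i
      proof -
        have "Inl (v, i) \<in> \<Union>M" using v i by (simp add: perf gadget_verts_def)
        then obtain e where e: "e \<in> M" "Inl (v, i) \<in> e" by blast
        obtain y where y: "e = {Inl (v, i), y}"
          using edge_other_end[OF gadget_simple_graph[OF G] edgeE[OF e(1)] e(2)] .
        then obtain h where h: "h \<in> half_edges G" "vertex_at G h = v" "e = {Inl (v, i), Inr h}"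
          using edgeE[OF e(1)] by (auto simp: gadget_copy_edge)
        have "{Inr h, Inr (mate h)} \<notin> M"
          using matching_eqI[OF M e(1), of "{Inr h, Inr (mate h)}" "Inr h"] h(3)
          by (auto simp: doubleton_eq_iff)
        then have hA: "h \<in> A" using h by (simp add: A_def HE)
        have "{Inr h, Inl (v, f h)} = e"
          using f[OF hA] e h by (intro matching_eqI[OF M, where x = "Inr h"]) auto
        then have "f h = i" using h(3) by (auto simp: doubleton_eq_iff)
        then show ?thesis using hA by blast
      qed
      then show "f ` A = {..<l}" using f by auto
    qed
    then have "card A = l" by (simp add: bij_betw_same_card[of f A])
    moreover have "finite (edges H)" using sub by (simp add: spanning_subgraph_def finite_multigraph_def)
    ultimately show ?thesis by (simp add: degree_half_edges at A_def)
  qed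
  then have "regular_graph l H" by (simp add: regular_graph_def H_def)
  then show ?thesis using sub by (auto simp: has_factor_def is_factor_def)
qed

lemma separates_step:
  assumes "separates V E X P" "{x, y} \<in> E" "K \<in> P" "x \<in> K" "y \<notin> X"
  shows "y \<in> K"
proof -
  have part: "partition_on (V - X) P" using assms by (simp add: separates_def)
  have "x \<notin> X" using part assms(3,4) by (auto simp: partition_on_def)
  then obtain L where L: "L \<in> P" "{x, y} \<subseteq> L" using assms by (auto simp: separates_def)
  then have "L = K" using partition_on_eqI[OF part, of L K x] assms by simp
  then show ?thesis using L by simp
qed

lemma card_blocks_meeting:
  assumes "partition_on A P" "finite Z"
  shows "card {K \<in> P. K \<inter> Z \<noteq> {}} \<le> card Z"
proof -
  let ?f = "\<lambda>z. THE K. K \<in> P \<and> z \<in> K"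
  have "K \<in> ?f ` Z" if K: "K \<in> P" and z: "z \<in> K" "z \<in> Z" for K z
  proof -
    have "?f z = K" using K z partition_on_eqI[OF assms(1)] by (intro the_equality) auto
    then show ?thesis using z by blast
  qed
  then have "{K \<in> P. K \<inter> Z \<noteq> {}} \<subseteq> ?f ` Z" by blast
  then show ?thesis using assms(2) by (rule surj_card_le[rotated])
qed

lemma even_card_mate_closed:
  assumes "finite A" "\<And>h. h \<in> A \<Longrightarrow> mate h \<in> A"
  shows "even (card A)"
proof -
  have "A = fst ` A \<times> UNIV"
  proof (intro equalityI subsetI)
    fix h assume "h \<in> fst ` A \<times> (UNIV :: bool set)"
    then obtain h' where "h' \<in> A" "fst h = fst h'" by auto
    then have "h = h' \<or> h = mate h'" using half_edges_of_same_edge by blast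
    then show "h \<in> A" using assms(2)[of h'] \<open>h' \<in> A\<close> by auto
  qed (auto simp: mem_Times_iff)
  then have "card A = card (fst ` A) * 2" by (metis card_UNIV_bool card_cartesian_product)
  then show ?thesis by simp
qed

text \<open>
  The part of the \<open>f\<close>-factor theorem of Belck and Tutte that yields an obstruction, for constant
  \<open>f\<close>.  Take a minimal barrier \<open>X\<close> of the gadget graph.  Since each of its vertices sees three odd
  blocks, a vertex of the multigraph falls into one of three classes: all its copies but no port are in
  \<open>X\<close> (the set \<open>S\<close>), all its ports but no copy are in \<open>X\<close> (the set \<open>T\<close>, to which isolated vertices are counted), or nothing of it is in
  \<open>X\<close>.  Hence \<open>X\<close> has \<open>l * card S + cross G T (verts G)\<close> elements.  An odd block contains a
  copy of a vertex of \<open>T\<close>, or a port of \<open>S\<close> whose mate is at \<open>T\<close>, or else it consists, up to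
  mated pairs of ports, of the copies of a set \<open>A\<close> of vertices of the third class and their ports
  facing \<open>T\<close>.  The sets \<open>A\<close> arising in the last way form \<open>Q\<close>.
\<close>

lemma factor_barrier:
  assumes G: "finite_multigraph G" and l: "0 < l" and ev: "even (l * card (verts G))"
    and no: "\<not> has_factor l G"
  obtains S T Q where "S \<subseteq> verts G" "T \<subseteq> verts G" "S \<inter> T = {}"
    "disjoint Q" "\<And>A. A \<in> Q \<Longrightarrow> A \<subseteq> verts G - S - T"
    "\<And>A. A \<in> Q \<Longrightarrow> cross G A (verts G - S - T - A) = 0"
    "\<And>A. A \<in> Q \<Longrightarrow> odd (l * card A + cross G A T)"
    "l * card S + cross G T (verts G) + 2 \<le> l * card T + cross G S T + card Q"
proof -
  let ?V = "gadget_verts G l" and ?E = "gadget_edges G l" and ?at = "vertex_at G"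
  let ?HE = "half_edges G"
  have G': "simple_graph ?V ?E" using gadget_simple_graph[OF G] .
  have fV: "finite (verts G)" using G by (simp add: finite_multigraph_def)
  have fHE: "finite ?HE" using finite_half_edges[OF G] .
  have "even (card ?V)" using ev by (simp add: gadget_card_verts[OF G] mult.commute)
  then obtain X P where sep: "separates ?V ?E X P"
    and big: "card X + 2 \<le> card (odd_blocks P)"
    and min: "\<And>x. x \<in> X \<Longrightarrow> 3 \<le> card (odd_neighbours ?E P x)"
    using tutte_barrier_minimal[OF G'] has_factor_if_perfect_matching[OF G] no by blast
  have part: "partition_on (?V - X) P" and XV: "X \<subseteq> ?V" using sep by (auto simp: separates_def)
  have UP: "\<Union>P = ?V - X" using part by (simp add: partition_on_def)
  note step = separates_step[OF sep]
  have fV': "finite ?V" using simple_graph_finite(1)[OF G'] .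
  have finP: "finite P" using finite_elements[OF _ part] fV' by simp
  define S where "S = {v \<in> verts G. \<exists>i<l. Inl (v, i) \<in> X}"
  define T where "T = {v \<in> verts G - S. \<forall>h \<in> ?HE. ?at h = v \<longrightarrow> Inr h \<in> X}"
  have ST: "S \<subseteq> verts G" "T \<subseteq> verts G" "S \<inter> T = {}" by (auto simp: S_def T_def)
  have block: "\<exists>K \<in> P. y \<in> K" if "y \<in> ?V" "y \<notin> X" for y using that UP by blast
  have portV: "Inr h \<in> ?V \<longleftrightarrow> h \<in> ?HE" for h by (auto simp: gadget_verts_def)
  have copyV: "Inl (v, i) \<in> ?V \<longleftrightarrow> v \<in> verts G \<and> i < l" for v i by (auto simp: gadget_verts_def)

  \<comment> \<open>Two odd blocks next to a copy of \<open>u\<close> contain different ports of \<open>u\<close>,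
    which any copy of \<open>u\<close> outside \<open>X\<close> would join.\<close>
  have S_copies: "Inl (u, j) \<in> X" if u: "u \<in> S" and j: "j < l" for u j
  proof (rule ccontr)
    assume nX: "Inl (u, j) \<notin> X"
    obtain i where i: "i < l" "Inl (u, i) \<in> X" using u by (auto simp: S_def)
    have "\<not> card (odd_neighbours ?E P (Inl (u, i))) \<le> Suc 0" using min[OF i(2)] by simp
    then obtain K1 K2 where K: "K1 \<in> odd_neighbours ?E P (Inl (u, i))"
      "K2 \<in> odd_neighbours ?E P (Inl (u, i))" "K1 \<noteq> K2"
      using finP by (subst (asm) card_le_Suc0_iff_eq) (auto simp: odd_neighbours_def odd_blocks_def)
    have all: "Inl (u, j) \<in> K" if KO: "K \<in> odd_neighbours ?E P (Inl (u, i))" for K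
    proof -
      obtain h where h: "Inr h \<in> K" "h \<in> ?HE" "?at h = u"
        using KO unfolding odd_neighbours_def gadget_copy_edge by blast
      have "K \<in> P" using KO by (auto simp: odd_neighbours_def odd_blocks_def)
      moreover have "{Inr h, Inl (u, j)} \<in> ?E" using h j by (auto simp: gadget_port_edge)
      ultimately show ?thesis using step h(1) nX by blast
    qed
    have "K1 = K2"
      using K all[OF K(1)] all[OF K(2)] partition_on_eqI[OF part, of K1 K2]
      by (auto simp: odd_neighbours_def odd_blocks_def)
    then show False using K(3) by simp
  qed
  \<comment> \<open>If all copies of its vertex are in \<open>X\<close>, a port sees only the block of its mate.\<close>
  have S_ports: "Inr h \<notin> X" if h: "h \<in> ?HE" "?at h \<in> S" for h
  proof
    assume hX: "Inr h \<in> X"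
    have "odd_neighbours ?E P (Inr h) \<subseteq> {K \<in> P. K \<inter> {Inr (mate h)} \<noteq> {}}"
      using S_copies[OF h(2)] UP
      by (auto simp: odd_neighbours_def odd_blocks_def gadget_port_edge)
    then have "card (odd_neighbours ?E P (Inr h)) \<le> card {K \<in> P. K \<inter> {Inr (mate h)} \<noteq> {}}"
      using finP by (intro card_mono) auto
    also have "\<dots> \<le> card {Inr (mate h) :: 'a \<times> nat + 'b \<times> bool}"
      using part by (intro card_blocks_meeting) auto
    finally show False using min[OF hX] by simp
  qed
  \<comment> \<open>A port \<open>h'\<close> outside \<open>X\<close> puts all copies of its vertex into one block, so that another
    port \<open>h\<close> of the same vertex sees at most that block and the block of its mate.\<close>
  have X_ports: "?at h \<in> T" if h: "h \<in> ?HE" "Inr h \<in> X" for h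
  proof (rule ccontr)
    assume "?at h \<notin> T"
    moreover have nS: "?at h \<notin> S" using S_ports h by blast
    ultimately obtain h' where h': "h' \<in> ?HE" "?at h' = ?at h" "Inr h' \<notin> X"
      using vertex_at_in_verts[OF G h(1)] by (auto simp: T_def)
    obtain K' where K': "K' \<in> P" "Inr h' \<in> K'" using block portV h' by blast
    have copies: "Inl (?at h, i) \<in> K'" if "i < l" for i
    proof -
      have "Inl (?at h, i) \<notin> X"
        using nS that vertex_at_in_verts[OF G h(1)] by (auto simp: S_def)
      moreover have "{Inr h', Inl (?at h, i)} \<in> ?E" using that h' by (auto simp: gadget_port_edge)
      ultimately show ?thesis using step K' by blast
    qed
    have "odd_neighbours ?E P (Inr h) \<subseteq>
        {K \<in> P. K \<inter> {Inr (mate h), Inl (?at h, 0)} \<noteq> {}}"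
    proof
      fix K assume K: "K \<in> odd_neighbours ?E P (Inr h)"
      then have KP: "K \<in> P" by (simp add: odd_neighbours_def odd_blocks_def)
      obtain y where y: "y \<in> K" "y = Inr (mate h) \<or> (\<exists>i<l. y = Inl (?at h, i))"
        using K by (auto simp: odd_neighbours_def gadget_port_edge)
      have "K = K'" if "i < l" "y = Inl (?at h, i)" for i
        using partition_on_eqI[OF part KP K'(1), of y] y(1) copies that by simp
      then have "K \<inter> {Inr (mate h), Inl (?at h, 0)} \<noteq> {}"
        using y copies[OF l] by auto
      then show "K \<in> {K \<in> P. K \<inter> {Inr (mate h), Inl (?at h, 0)} \<noteq> {}}" using KP by simp
    qed
    then have "card (odd_neighbours ?E P (Inr h)) \<le>
        card {K \<in> P. K \<inter> {Inr (mate h), Inl (?at h, 0)} \<noteq> {}}"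
      using finP by (intro card_mono) auto
    also have "\<dots> \<le> card {Inr (mate h) :: 'a \<times> nat + 'b \<times> bool, Inl (?at h, 0)}"
      using part by (intro card_blocks_meeting) auto
    finally show False using min[OF h(2)] by simp
  qed
  have portX: "Inr h \<in> X \<longleftrightarrow> ?at h \<in> T" if "h \<in> ?HE" for h
    using X_ports[OF that] that unfolding T_def by blast
  have copyX: "Inl (v, i) \<in> X \<longleftrightarrow> v \<in> S" if "v \<in> verts G" "i < l" for v i
    using S_copies[of v i] that unfolding S_def by blast

  have "X = Inl ` (S \<times> {..<l}) \<union> Inr ` {h \<in> ?HE. ?at h \<in> T \<and> ?at (mate h) \<in> verts G}"
  proof (intro equalityI subsetI)
    fix x assume x: "x \<in> X"
    show "x \<in> Inl ` (S \<times> {..<l}) \<union> Inr ` {h \<in> ?HE. ?at h \<in> T \<and> ?at (mate h) \<in> verts G}"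
    proof (cases x)
      case (Inl p)
      obtain v i where p: "p = (v, i)" by fastforce
      have vi: "v \<in> verts G" "i < l" using x XV Inl p copyV by auto
      then show ?thesis using copyX[OF vi] x Inl p by simp
    next
      case (Inr h)
      have h: "h \<in> ?HE" using subsetD[OF XV x] Inr portV[of h] by simp
      then show ?thesis
        using X_ports[OF h] x Inr vertex_at_in_verts[OF G, of "mate h"] by simp
    qed
  qed (use S_copies portX in auto)
  then have "card X = card (Inl ` (S \<times> {..<l}) :: ('a \<times> nat + 'b \<times> bool) set) +
      card (Inr ` {h \<in> ?HE. ?at h \<in> T \<and> ?at (mate h) \<in> verts G} :: ('a \<times> nat + 'b \<times> bool) set)"
    using ST fV fHE finite_subset by (simp only:, intro card_Un_disjoint) auto
  then have cardX: "card X = l * card S + cross G T (verts G)"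
    by (simp add: card_image card_cartesian_product cross_def)

  define ZA :: "('a \<times> nat + 'b \<times> bool) set" where "ZA = Inl ` (T \<times> {..<l})"
  define ZB :: "('a \<times> nat + 'b \<times> bool) set"
    where "ZB = Inr ` {h \<in> ?HE. ?at h \<in> S \<and> ?at (mate h) \<in> T}"
  define C where "C = {K \<in> odd_blocks P. K \<inter> ZA = {} \<and> K \<inter> ZB = {}}"
  define q where "q K = {u \<in> verts G - S - T. Inl (u, 0) \<in> K}" for K :: "('a \<times> nat + 'b \<times> bool) set"
  have finT: "finite T" by (rule finite_subset[OF ST(2) fV])
  have cZA: "card {K \<in> P. K \<inter> ZA \<noteq> {}} \<le> l * card T"
    using card_blocks_meeting[OF part, of ZA] finT
    by (simp add: ZA_def card_image card_cartesian_product mult.commute)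
  have cZB: "card {K \<in> P. K \<inter> ZB \<noteq> {}} \<le> cross G S T"
    using card_blocks_meeting[OF part, of ZB] fHE
    by (simp add: ZB_def card_image cross_def)
  have "odd_blocks P \<subseteq> {K \<in> P. K \<inter> ZA \<noteq> {}} \<union> {K \<in> P. K \<inter> ZB \<noteq> {}} \<union> C"
    by (auto simp: C_def odd_blocks_def)
  then have "card (odd_blocks P) \<le> card ({K \<in> P. K \<inter> ZA \<noteq> {}} \<union> {K \<in> P. K \<inter> ZB \<noteq> {}} \<union> C)"
    using finP by (intro card_mono) (auto simp: C_def odd_blocks_def)
  also have "\<dots> \<le> card {K \<in> P. K \<inter> ZA \<noteq> {}} + card {K \<in> P. K \<inter> ZB \<noteq> {}} + card C"
    by (meson card_Un_le add_le_mono1 order_trans)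
  finally have cardO: "card (odd_blocks P) \<le> l * card T + cross G S T + card C"
    using cZA cZB by linarith

  \<comment> \<open>A vertex outside \<open>S\<close> and \<open>T\<close> has a port outside \<open>X\<close>, which keeps its copies together.\<close>
  have U_block: "Inl (u, i) \<in> K \<longleftrightarrow> u \<in> q K"
    if u: "u \<in> verts G" "u \<notin> S" "u \<notin> T" and i: "i < l" and K: "K \<in> P" for u i K
  proof -
    obtain h where h: "h \<in> ?HE" "?at h = u" "Inr h \<notin> X" using u by (auto simp: T_def)
    obtain L where L: "L \<in> P" "Inr h \<in> L" using block portV h by blast
    have cp: "Inl (u, j) \<in> L" if "j < l" for j
    proof -
      have "{Inr h, Inl (u, j)} \<in> ?E" using h that by (auto simp: gadget_port_edge)
      then show ?thesis using step L copyX[OF u(1) that] u(2) by blast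
    qed
    have "Inl (u, j) \<in> K \<longleftrightarrow> K = L" if "j < l" for j
      using partition_on_eqI[OF part K L(1) _ cp[OF that]] cp[OF that] by blast
    then show ?thesis using i l u by (auto simp: q_def)
  qed
  have port_q: "Inr h \<in> K \<longleftrightarrow> ?at h \<in> q K"
    if h: "h \<in> ?HE" "?at h \<notin> S" "?at h \<notin> T" and K: "K \<in> P" for h K
  proof -
    have v: "?at h \<in> verts G" using vertex_at_in_verts[OF G h(1)] .
    have e: "{Inr h, Inl (?at h, 0)} \<in> ?E" using h l by (auto simp: gadget_port_edge)
    have n: "Inr h \<notin> X" "Inl (?at h, 0) \<notin> X" using portX copyX[OF v l] h by auto
    have "Inr h \<in> K \<longleftrightarrow> Inl (?at h, 0) \<in> K"
      using step[OF e K _ n(2)] step[of "Inl (?at h, 0)" "Inr h" K] e K n(1)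
      by (metis insert_commute)
    then show ?thesis using U_block[OF v h(2,3) l K] by simp
  qed
  have mate_K: "Inr (mate h) \<in> K"
    if h: "h \<in> ?HE" "Inr h \<in> K" "?at (mate h) \<notin> T" and K: "K \<in> P" for h K
    using step[OF _ K h(2), of "Inr (mate h)"] portX[of "mate h"] h by (auto simp: gadget_port_edge)
  have odd_q: "odd (l * card (q K) + cross G (q K) T)" if K: "K \<in> C" for K
  proof -
    have KP: "K \<in> P" and Kodd: "odd (card K)" and KZ: "K \<inter> ZA = {}" "K \<inter> ZB = {}"
      using K by (auto simp: C_def odd_blocks_def)
    have KV: "K \<subseteq> ?V - X" using KP UP by blast
    \<comment> \<open>\<open>D\<close> holds the ports facing \<open>T\<close>, whose mates are in \<open>X\<close>; the other ports \<open>R\<close> of the block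
      come in mated pairs.\<close>
    define D where "D = {h \<in> ?HE. ?at h \<in> q K \<and> ?at (mate h) \<in> T}"
    define R where "R = {h \<in> ?HE. Inr h \<in> K \<and> ?at (mate h) \<notin> T}"
    have Keq: "K = Inl ` (q K \<times> {..<l}) \<union> Inr ` (D \<union> R)"
    proof (intro equalityI subsetI)
      fix x assume x: "x \<in> K"
      then have xV: "x \<in> ?V" "x \<notin> X" using KV by auto
      show "x \<in> Inl ` (q K \<times> {..<l}) \<union> Inr ` (D \<union> R)"
      proof (cases x)
        case (Inl p)
        obtain u i where p: "p = (u, i)" by fastforce
        have ui: "u \<in> verts G" "i < l" using xV Inl p copyV by auto
        have "u \<notin> S" using copyX[OF ui] xV Inl p by simp
        moreover have "u \<notin> T" using KZ x Inl p ui by (auto simp: ZA_def)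
        ultimately have "u \<in> q K" using U_block[OF ui(1) _ _ ui(2) KP] x Inl p by simp
        then show ?thesis using Inl p ui by auto
      next
        case (Inr h)
        have h: "h \<in> ?HE" using xV Inr portV[of h] by simp
        have hT: "?at h \<notin> T" using portX[OF h] xV Inr by simp
        show ?thesis
        proof (cases "?at (mate h) \<in> T")
          case True
          then have "?at h \<notin> S" using KZ x Inr h by (auto simp: ZB_def)
          then have "?at h \<in> q K" using port_q[OF h _ hT KP] x Inr by simp
          then show ?thesis using True h Inr by (auto simp: D_def)
        next
          case False
          then show ?thesis using x Inr h by (auto simp: R_def)
        qed
      qed
    next
      fix x assume "x \<in> Inl ` (q K \<times> {..<l}) \<union> Inr ` (D \<union> R)"
      then consider u i where "x = Inl (u, i)" "u \<in> q K" "i < l"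
        | h where "x = Inr h" "h \<in> D" | h where "x = Inr h" "h \<in> R" by blast
      then show "x \<in> K"
      proof cases
        case 1
        then show ?thesis using U_block[OF _ _ _ 1(3) KP, of u] by (simp add: q_def)
      next
        case 2
        then show ?thesis using port_q[OF _ _ _ KP, of h] by (simp add: D_def q_def)
      next
        case 3
        then show ?thesis by (simp add: R_def)
      qed
    qed
    have fin: "finite (q K)" "finite D" "finite R"
      using fV fHE by (auto simp: q_def D_def R_def)
    have "card K = card (Inl ` (q K \<times> {..<l}) :: ('a \<times> nat + 'b \<times> bool) set) +
        card (Inr ` (D \<union> R) :: ('a \<times> nat + 'b \<times> bool) set)"
      using fin by (subst Keq, intro card_Un_disjoint) auto
    also have "\<dots> = l * card (q K) + card (D \<union> R)"
      by (simp add: card_image card_cartesian_product mult.commute)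
    also have "card (D \<union> R) = card D + card R"
      using fin by (intro card_Un_disjoint) (auto simp: D_def R_def)
    also have "card D = cross G (q K) T" by (simp add: D_def cross_def)
    finally have "card K = l * card (q K) + cross G (q K) T + card R" by simp
    moreover have "even (card R)"
    proof (rule even_card_mate_closed[OF fin(3)])
      fix h assume h: "h \<in> R"
      then have "Inr h \<notin> X" using KV by (auto simp: R_def)
      then have "?at h \<notin> T" using portX h by (auto simp: R_def)
      then show "mate h \<in> R" using h mate_K[OF _ _ _ KP] by (auto simp: R_def)
    qed
    ultimately show ?thesis using Kodd by simp
  qed
  have CP: "C \<subseteq> P" by (auto simp: C_def odd_blocks_def)
  have q_eq: "K = L" if "K \<in> C" "L \<in> C" "u \<in> q K" "u \<in> q L" for K L u
    using that CP partition_on_eqI[OF part, of K L "Inl (u, 0)"] by (auto simp: q_def)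
  have q_ne: "q K \<noteq> {}" if "K \<in> C" for K
    using odd_q[OF that] by (cases "q K = {}") (auto simp: cross_def)
  have "inj_on q C"
  proof (rule inj_onI)
    fix K L assume KL: "K \<in> C" "L \<in> C" "q K = q L"
    obtain u where "u \<in> q K" using q_ne[OF KL(1)] by blast
    then show "K = L" using q_eq[OF KL(1,2)] KL(3) by simp
  qed
  then have cardQ: "card (q ` C) = card C" by (rule card_image)
  show ?thesis
  proof (rule that[OF ST, of "q ` C"])
    show "disjoint (q ` C)" unfolding disjoint_def using q_eq by blast
    show "A \<subseteq> verts G - S - T" if "A \<in> q ` C" for A using that by (auto simp: q_def)
    show "odd (l * card A + cross G A T)" if "A \<in> q ` C" for A using that odd_q by auto
    show "l * card S + cross G T (verts G) + 2 \<le> l * card T + cross G S T + card (q ` C)"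
      using big cardX cardO cardQ by linarith
    show "cross G A (verts G - S - T - A) = 0" if A: "A \<in> q ` C" for A
    proof -
      obtain K where K: "K \<in> C" "A = q K" using A by blast
      have False if h: "h \<in> ?HE" "?at h \<in> q K" "?at (mate h) \<in> verts G - S - T - q K" for h
      proof -
        have KP: "K \<in> P" using K CP by blast
        have "Inr h \<in> K" using port_q[OF h(1) _ _ KP] h(2) by (auto simp: q_def)
        then have "Inr (mate h) \<in> K" using mate_K[OF h(1) _ _ KP] h by simp
        then show False using port_q[OF _ _ _ KP, of "mate h"] h by auto
      qed
      then have "{h \<in> ?HE. ?at h \<in> q K \<and> ?at (mate h) \<in> verts G - S - T - q K} = {}" by blast
      then show ?thesis by (simp only: K(2) cross_def card.empty)
    qed
  qed
qed

section \<open>Cut-edges\<close>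

lemma adj_rel_sym: "sym (adj_rel G)"
  by (auto simp: adj_rel_def sym_def Upair_inject) (metis Upair_inject)

lemma equiv_conn_rel: "equiv (verts G) (conn_rel G)"
proof (rule equivI)
  have "sym ((adj_rel G)\<^sup>*)" using adj_rel_sym by (rule sym_rtrancl)
  then show "sym (conn_rel G)" by (auto simp: conn_rel_def sym_def)
  show "trans (conn_rel G)" by (auto simp: conn_rel_def trans_def)
  show "refl_on (verts G) (conn_rel G)" "conn_rel G \<subseteq> verts G \<times> verts G"
    by (auto simp: conn_rel_def refl_on_def)
qed

text \<open>
  Deleting an edge refines the connectedness relation, and a proper refinement has more classes.
\<close>

lemma card_quotient_refine:
  assumes fin: "finite V" and R: "equiv V R" and S: "equiv V S" and RS: "R \<subseteq> S"
    and uv: "(u, v) \<in> S" "(u, v) \<notin> R"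
  shows "card (V // S) < card (V // R)"
proof -
  let ?f = "\<lambda>K. S `` K"
  have f: "?f (R `` {x}) = S `` {x}" if "x \<in> V" for x
  proof -
    have "x \<in> R `` {x}" using R that by (rule equiv_class_self)
    moreover have "S `` {y} = S `` {x}" if "y \<in> R `` {x}" for y
      using that RS equiv_class_eq[OF S, of x y] by auto
    ultimately show ?thesis by blast
  qed
  have quot: "V // T = (\<lambda>x. T `` {x}) ` V" for T :: "('a \<times> 'a) set"
    by (auto simp: quotient_def)
  have img: "?f ` (V // R) = V // S"
    unfolding quot image_image by (rule image_cong[OF refl f])
  have finR: "finite (V // R)" by (rule finite_quotient[OF fin equiv_type[OF R]])
  have V: "u \<in> V" "v \<in> V" using uv(1) equiv_type[OF S] by auto
  have "?f (R `` {u}) = ?f (R `` {v})"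
    unfolding f[OF V(1)] f[OF V(2)] by (rule equiv_class_eq[OF S uv(1)])
  moreover have "R `` {u} \<noteq> R `` {v}" using uv(2) eq_equiv_class[OF _ R V(2)] by blast
  moreover have "R `` {u} \<in> V // R" "R `` {v} \<in> V // R" using V by (auto intro: quotientI)
  ultimately have "\<not> inj_on ?f (V // R)" by (meson inj_onD)
  then have "card (?f ` (V // R)) \<noteq> card (V // R)" using finR eq_card_imp_inj_on by blast
  then show ?thesis using card_image_le[OF finR, of ?f] by (simp add: img)
qed

theorem cut_edge_iff:
  assumes G: "finite_multigraph G" and e: "e \<in> edges G" and uv: "ends G e = Upair u v"
  shows "e \<in> cut_edges G \<longleftrightarrow> (u, v) \<notin> (adj_rel (delete_edge G e))\<^sup>*"
proof -
  let ?G' = "delete_edge G e"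
  have V: "verts ?G' = verts G" by (simp add: delete_edge_def)
  have sub: "adj_rel ?G' \<subseteq> adj_rel G" by (auto simp: adj_rel_def delete_edge_def)
  have adj: "(u, v) \<in> adj_rel G" using e uv by (auto simp: adj_rel_def)
  have uvV: "u \<in> verts G" "v \<in> verts G" using G e uv by (auto simp: finite_multigraph_def)
  show ?thesis
  proof (cases "(u, v) \<in> (adj_rel ?G')\<^sup>*")
    case True
    have "(v, u) \<in> (adj_rel ?G')\<^sup>*"
      using True by (rule symD[OF sym_rtrancl[OF adj_rel_sym]])
    moreover have "(x, y) = (u, v) \<or> (x, y) = (v, u) \<or> (x, y) \<in> adj_rel ?G'"
      if "(x, y) \<in> adj_rel G" for x y
      using that uv by (auto simp: adj_rel_def delete_edge_def)
    ultimately have "(x, y) \<in> (adj_rel ?G')\<^sup>*" if "(x, y) \<in> adj_rel G" for x y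
      using that True by blast
    then have "adj_rel G \<subseteq> (adj_rel ?G')\<^sup>*" by (rule subrelI)
    then have "(adj_rel G)\<^sup>* = (adj_rel ?G')\<^sup>*"
      using sub by (metis rtrancl_subset)
    then show ?thesis using True by (simp add: cut_edges_def components_of_graph_def conn_rel_def V)
  next
    case False
    have "conn_rel ?G' \<subseteq> conn_rel G" using rtrancl_mono[OF sub] by (auto simp: conn_rel_def V)
    moreover have "(u, v) \<in> conn_rel G" using adj uvV by (auto simp: conn_rel_def)
    moreover have "(u, v) \<notin> conn_rel ?G'" using False by (simp add: conn_rel_def)
    moreover have "finite (verts G)" using G by (simp add: finite_multigraph_def)
    ultimately have "card (verts G // conn_rel G) < card (verts G // conn_rel ?G')"
      using equiv_conn_rel[of G] equiv_conn_rel[of ?G'] unfolding V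
      by (intro card_quotient_refine)
    then show ?thesis using False e by (simp add: cut_edges_def components_of_graph_def V)
  qed
qed

lemma cut_edgeI:
  assumes G: "finite_multigraph G" and e: "e \<in> edges G" and uv: "ends G e = Upair u v"
    and A: "u \<in> A" "v \<notin> A"
    and closed: "\<And>e' x y. e' \<in> edges G - {e} \<Longrightarrow> ends G e' = Upair x y \<Longrightarrow> x \<in> A \<Longrightarrow> y \<in> A"
  shows "e \<in> cut_edges G"
proof -
  have "y \<in> A" if "(u, y) \<in> (adj_rel (delete_edge G e))\<^sup>*" for y
    using that
  proof induction
    case (step y z)
    then show ?case using closed by (auto simp: adj_rel_def delete_edge_def)
  qed (rule A)
  then show ?thesis using A by (subst cut_edge_iff[OF G e uv]) blast
qed

section \<open>Regular graphs of odd degree\<close>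

lemma cross_commute: "cross G A B = cross G B A"
proof -
  have "mate ` {h \<in> half_edges G. vertex_at G h \<in> A \<and> vertex_at G (mate h) \<in> B} =
      {h \<in> half_edges G. vertex_at G h \<in> B \<and> vertex_at G (mate h) \<in> A}" (is "mate ` ?L = ?R")
  proof (intro equalityI subsetI)
    fix h assume "h \<in> ?R"
    then have "mate h \<in> ?L" "h = mate (mate h)" by simp_all
    then show "h \<in> mate ` ?L" by (rule rev_image_eqI)
  next
    fix h assume "h \<in> mate ` ?L"
    then obtain g where "g \<in> ?L" "h = mate g" by (rule imageE)
    then show "h \<in> ?R" by simp
  qed
  moreover have "card (mate ` ?L) = card ?L"
    by (rule card_image, rule inj_onI) (simp only: mate_eq_iff)
  ultimately show ?thesis unfolding cross_def by simp
qed

lemma cross_empty [simp]: "cross G {} A = 0"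
  by (simp add: cross_def)

lemma cross_mono:
  assumes "finite_multigraph G" "A \<subseteq> A'" "B \<subseteq> B'"
  shows "cross G A B \<le> cross G A' B'"
  unfolding cross_def using finite_half_edges[OF assms(1)] assms(2,3)
  by (intro card_mono) auto

lemma cross_Un_left:
  assumes "finite_multigraph G" "A \<inter> A' = {}"
  shows "cross G (A \<union> A') B = cross G A B + cross G A' B"
proof -
  have "{h \<in> half_edges G. vertex_at G h \<in> A \<union> A' \<and> vertex_at G (mate h) \<in> B} =
      {h \<in> half_edges G. vertex_at G h \<in> A \<and> vertex_at G (mate h) \<in> B} \<union>
      {h \<in> half_edges G. vertex_at G h \<in> A' \<and> vertex_at G (mate h) \<in> B}" by auto
  then show ?thesis unfolding cross_def using finite_half_edges[OF assms(1)] assms(2)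
    by (simp only:, intro card_Un_disjoint) auto
qed

lemma cross_Union_left:
  assumes G: "finite_multigraph G" and "finite Q" "disjoint Q"
  shows "cross G (\<Union>Q) B = (\<Sum>A\<in>Q. cross G A B)"
  using assms(2,3)
proof (induction Q)
  case (insert A Q)
  have "A \<inter> \<Union>Q = {}" using insert.hyps insert.prems unfolding disjoint_def by auto
  then show ?case
    using insert cross_Un_left[OF G, of A "\<Union>Q" B] by (simp add: pairwise_insert)
qed simp

lemma cross_regular:
  assumes G: "finite_multigraph G" and d: "regular_graph d G" and A: "A \<subseteq> verts G"
  shows "cross G A (verts G) = d * card A"
proof -
  have fin: "finite A" using G A finite_subset by (auto simp: finite_multigraph_def)
  have "vertex_at G (mate h) \<in> verts G" if "h \<in> half_edges G" for h
    using vertex_at_in_verts[OF G, of "mate h"] that by simp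
  then have "{h \<in> half_edges G. vertex_at G h \<in> A \<and> vertex_at G (mate h) \<in> verts G} =
      (\<Union>v\<in>A. {h \<in> half_edges G. vertex_at G h = v})" by blast
  then have "cross G A (verts G) = (\<Sum>v\<in>A. card {h \<in> half_edges G. vertex_at G h = v})"
    unfolding cross_def using fin finite_half_edges[OF G]
    by (simp only:, intro card_UN_disjoint) auto
  also have "\<dots> = (\<Sum>v\<in>A. d)"
    using d A G by (intro sum.cong)
      (auto simp: regular_graph_def degree_half_edges[symmetric] finite_multigraph_def)
  finally show ?thesis by simp
qed

text \<open>
  A set of vertices that sends a single edge out, here into \<open>T\<close>, sends out a cut-edge.
\<close>

lemma cut_edge_of_block:
  assumes G: "finite_multigraph G" and ST: "S \<subseteq> verts G" "T \<subseteq> verts G" "S \<inter> T = {}"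
    and A: "A \<subseteq> verts G - S - T"
    and one: "cross G A T = 1" "cross G A S = 0" "cross G A (verts G - S - T - A) = 0"
  shows "\<exists>h. fst h \<in> cut_edges G \<and> vertex_at G h \<in> A \<and> vertex_at G (mate h) \<in> T"
proof -
  have fin: "finite {h \<in> half_edges G. P h}" for P using finite_half_edges[OF G] by simp
  obtain h where h: "{h \<in> half_edges G. vertex_at G h \<in> A \<and> vertex_at G (mate h) \<in> T} = {h}"
    using one(1) unfolding cross_def by (meson card_1_singletonE)
  have h': "h \<in> half_edges G" "vertex_at G h \<in> A" "vertex_at G (mate h) \<in> T" using h by auto
  have none: "{h \<in> half_edges G. vertex_at G h \<in> A \<and> vertex_at G (mate h) \<in> S} = {}"
    "{h \<in> half_edges G. vertex_at G h \<in> A \<and> vertex_at G (mate h) \<in> verts G - S - T - A} = {}"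
    using one(2,3) fin by (simp_all add: cross_def)
  have "vertex_at G (mate g) \<in> T"
    if "g \<in> half_edges G" "vertex_at G g \<in> A" "vertex_at G (mate g) \<notin> A" for g
  proof -
    have "vertex_at G (mate g) \<in> verts G" using that vertex_at_in_verts[OF G, of "mate g"] by simp
    with that none show ?thesis by blast
  qed
  then have leave: "g = h"
    if "g \<in> half_edges G" "vertex_at G g \<in> A" "vertex_at G (mate g) \<notin> A" for g
    using that h by blast
  have "fst h \<in> cut_edges G"
  proof (rule cut_edgeI[OF G _ ends_half_edge h'(2)])
    show "fst h \<in> edges G" using h'(1) by (auto simp: half_edges_def)
    show "vertex_at G (mate h) \<notin> A" using h'(3) A by auto
    fix e x y assume e: "e \<in> edges G - {fst h}" "ends G e = Upair x y" "x \<in> A"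
    obtain g where g: "fst g = e" "vertex_at G g = x" "vertex_at G (mate g) = y"
      using e(2) ends_half_edge[of G "(e, False)"] by (auto simp: mate_def)
    then have "g \<in> half_edges G" using e(1) by (simp add: half_edges_def mem_Times_iff)
    then show "y \<in> A" using leave[of g] g e by auto
  qed
  then show ?thesis using h' by blast
qed

text \<open>
  Without a factor there is a barrier \<open>S\<close>, \<open>T\<close>, \<open>Q\<close>.  Let \<open>B\<close> be the set of blocks whose only edge to
  \<open>S\<close> or \<open>T\<close> is one edge to \<open>T\<close>; these give distinct cut-edges.  A block has an odd number of edges to \<open>T\<close>, so the number of
  its edges to \<open>T\<close> plus twice the number of its edges to \<open>S\<close> is at least 3 outside \<open>B\<close>, and 1 in
  \<open>B\<close>.  Summing this over the blocks and counting the edges at \<open>S\<close> and at \<open>T\<close>, the edges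
  between \<open>S\<close> and \<open>T\<close> cancel and \<open>card B \<ge> (2 r + 1 - 3 k) (card T - card S) + 3\<close> remains.
  Comparing just the edges at \<open>T\<close> gives \<open>card T > card S\<close>.
\<close>

theorem regular_graph_has_even_factor:
  assumes G: "finite_multigraph G" and reg: "regular_graph (2 * r + 1) G"
    and k: "0 < k" "3 * k \<le> 2 * r + 1"
    and cut: "card (cut_edges G) + 3 * k \<le> 2 * r + 3"
  shows "has_factor (2 * k) G"
proof (rule ccontr)
  assume no: "\<not> has_factor (2 * k) G"
  have pos: "0 < 2 * k" and ev: "even (2 * k * card (verts G))" using k(1) by simp_all
  show False
  proof (rule factor_barrier[OF G pos ev no])
    fix S T :: "'a set" and Q :: "'a set set"
    assume ST: "S \<subseteq> verts G" "T \<subseteq> verts G" "S \<inter> T = {}" and disj: "disjoint Q"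
      and Q: "\<And>A. A \<in> Q \<Longrightarrow> A \<subseteq> verts G - S - T"
      and closed: "\<And>A. A \<in> Q \<Longrightarrow> cross G A (verts G - S - T - A) = 0"
      and parity: "\<And>A. A \<in> Q \<Longrightarrow> odd (2 * k * card A + cross G A T)"
      and barrier: "2 * k * card S + cross G T (verts G) + 2 \<le>
        2 * k * card T + cross G S T + card Q"
    have finV: "finite (verts G)" using G by (simp add: finite_multigraph_def)
    have "Q \<subseteq> Pow (verts G)" using Q by blast
    then have finQ: "finite Q" using finV by (meson finite_Pow_iff finite_subset)
    have UQ: "\<Union>Q \<subseteq> verts G - S - T" using Q by blast
    have parity': "odd (cross G A T)" if "A \<in> Q" for A using parity[OF that] by simp
    define B where "B = {A \<in> Q. cross G A T = 1 \<and> cross G A S = 0}"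
    define c where "c = cross G S T"
    \<comment> \<open>Edge count at \<open>X\<close>, used for \<open>X = T\<close> with \<open>Y = S\<close> and for \<open>X = S\<close> with \<open>Y = T\<close>.\<close>
    have spread: "c' + (\<Sum>A\<in>Q. cross G A X) \<le> (2 * r + 1) * card X"
      if X: "X \<subseteq> verts G" and Y: "Y \<subseteq> verts G" "Y \<inter> \<Union>Q = {}" "c' = cross G Y X" for X Y c'
    proof -
      have "c' + (\<Sum>A\<in>Q. cross G A X) = cross G (Y \<union> \<Union>Q) X"
        using Y cross_Un_left[OF G Y(2), of X] cross_Union_left[OF G finQ disj, of X] by simp
      also have "\<dots> \<le> cross G (verts G) X"
        using UQ Y(1) by (intro cross_mono[OF G]) auto
      also have "\<dots> = (2 * r + 1) * card X"
        using cross_regular[OF G reg X] by (simp add: cross_commute[of G "verts G"])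
      finally show ?thesis .
    qed
    have T_edges: "c + (\<Sum>A\<in>Q. cross G A T) \<le> (2 * r + 1) * card T"
      using UQ by (intro spread[of T S]) (auto simp: c_def ST)
    have S_edges: "c + (\<Sum>A\<in>Q. cross G A S) \<le> (2 * r + 1) * card S"
      using UQ by (intro spread[of S T]) (auto simp: c_def ST cross_commute[of G S T])
    have "(\<Sum>A\<in>Q. 1) \<le> (\<Sum>A\<in>Q. cross G A T)"
      using parity' by (intro sum_mono) (metis One_nat_def Suc_leI odd_pos)
    then have Q_le: "card Q \<le> (\<Sum>A\<in>Q. cross G A T)" by simp
    have "(\<Sum>A\<in>Q. 3) \<le> (\<Sum>A\<in>Q. cross G A T + 2 * cross G A S + (if A \<in> B then 2 else 0))"
    proof (rule sum_mono)
      fix A assume A: "A \<in> Q"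
      have "cross G A T = 1 \<or> 3 \<le> cross G A T" using parity'[OF A] by presburger
      then show "3 \<le> cross G A T + 2 * cross G A S + (if A \<in> B then 2 else 0)"
        using A by (auto simp: B_def)
    qed
    also have "\<dots> = (\<Sum>A\<in>Q. cross G A T) + 2 * (\<Sum>A\<in>Q. cross G A S) + 2 * card B"
      using finQ by (simp add: sum.distrib sum_distrib_left sum.If_cases B_def Int_def)
    finally have weights:
      "3 * card Q \<le> (\<Sum>A\<in>Q. cross G A T) + 2 * (\<Sum>A\<in>Q. cross G A S) + 2 * card B" by simp

    have "card B \<le> card (cut_edges G)"
    proof -
      have "\<forall>A\<in>B. \<exists>h. fst h \<in> cut_edges G \<and> vertex_at G h \<in> A \<and> vertex_at G (mate h) \<in> T"
        using cut_edge_of_block[OF G ST Q] closed by (simp add: B_def)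
      then obtain h where h: "\<And>A. A \<in> B \<Longrightarrow> fst (h A) \<in> cut_edges G \<and> vertex_at G (h A) \<in> A \<and>
          vertex_at G (mate (h A)) \<in> T" by metis
      have "inj_on (\<lambda>A. fst (h A)) B"
      proof (rule inj_onI)
        fix A A' assume A: "A \<in> B" "A' \<in> B" "fst (h A) = fst (h A')"
        have "A \<inter> T = {}" using A(1) Q[of A] by (auto simp: B_def)
        have "h A = h A' \<or> h A = mate (h A')"
          using A(3) by (rule half_edges_of_same_edge)
        then have "vertex_at G (h A) \<in> A \<inter> A'"
        proof (elim disjE)
          assume "h A = mate (h A')"
          then have "vertex_at G (h A) \<in> T" using h[OF A(2)] by simp
          then show ?thesis using h[OF A(1)] \<open>A \<inter> T = {}\<close> by blast
        qed (use h[OF A(1)] h[OF A(2)] in simp)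
        moreover have "A \<in> Q" "A' \<in> Q" using A(1,2) by (simp_all add: B_def)
        ultimately show "A = A'" using disj unfolding disjoint_def by (metis empty_iff)
      qed
      moreover have "finite (cut_edges G)" using G by (simp add: cut_edges_def finite_multigraph_def)
      ultimately show ?thesis using h by (intro card_inj_on_le[of "\<lambda>A. fst (h A)"]) auto
    qed

    define s where "s = int (card S)"
    define t where "t = int (card T)"
    define d where "d = int (2 * r + 1)"
    define \<sigma> where "\<sigma> = (\<Sum>A\<in>Q. cross G A S)"
    define \<tau> where "\<tau> = (\<Sum>A\<in>Q. cross G A T)"
    have "cross G T (verts G) = (2 * r + 1) * card T" by (rule cross_regular[OF G reg ST(2)])
    then have "2 * k * card S + (2 * r + 1) * card T + 2 \<le> 2 * k * card T + c + card Q"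
      using barrier by (simp add: c_def)
    then have "int (2 * k * card S + (2 * r + 1) * card T + 2) \<le> int (2 * k * card T + c + card Q)"
      by (simp only: of_nat_le_iff)
    then have b: "2 * int k * s + d * t + 2 \<le> 2 * int k * t + int c + int (card Q)"
      by (simp only: s_def t_def d_def of_nat_mult of_nat_add of_nat_numeral)
    have "int (c + \<tau>) \<le> int ((2 * r + 1) * card T)"
      using T_edges by (simp only: \<tau>_def of_nat_le_iff)
    then have i1: "int c + int \<tau> \<le> d * t" by (simp only: t_def d_def of_nat_mult of_nat_add)
    have "int (c + \<sigma>) \<le> int ((2 * r + 1) * card S)"
      using S_edges by (simp only: \<sigma>_def of_nat_le_iff)
    then have i2: "int c + int \<sigma> \<le> d * s" by (simp only: s_def d_def of_nat_mult of_nat_add)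
    have i3: "int (card Q) \<le> int \<tau>" using Q_le by (simp only: \<tau>_def of_nat_le_iff)
    have i4: "3 * int (card Q) \<le> int \<tau> + 2 * int \<sigma> + 2 * int (card B)"
      using weights unfolding \<sigma>_def \<tau>_def by linarith
    have b': "2 * (int k * s) + d * t + 2 \<le> 2 * (int k * t) + int c + int (card Q)"
      using b by (simp only: mult.assoc)
    then have "int k * s < int k * t" using i1 i3 by linarith
    then have "s < t" using k(1) by simp
    moreover have "0 \<le> d - 3 * int k" using k(2) by (simp add: d_def)
    ultimately have "(d - 3 * int k) * 1 \<le> (d - 3 * int k) * (t - s)"
      by (intro mult_left_mono) auto
    moreover have "6 * (int k * s) + 2 * (d * t) + 6 \<le> 6 * (int k * t) + 2 * (d * s) + 2 * int (card B)"
      using b' i1 i2 i4 by linarith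
    then have "(d - 3 * int k) * (t - s) + 3 \<le> int (card B)" by (simp add: algebra_simps)
    ultimately have "int (2 * r + 1) - 3 * int k + 3 \<le> int (card B)" by (simp add: d_def)
    then show False using \<open>card B \<le> card (cut_edges G)\<close> cut by linarith
  qed
qed

section \<open>Extremal graphs\<close>

text \<open>
  Both extremal graphs consist of hubs and satellites, with every edge belonging to one satellite.
  The number of an edge encodes the satellite and a slot of this satellite.
\<close>

definition satellite :: "nat \<Rightarrow> nat" where "satellite e = fst (prod_decode e)"
definition slot :: "nat \<Rightarrow> nat" where "slot e = snd (prod_decode e)"

lemma satellite_slot_encode [simp]:
  "satellite (prod_encode (w, i)) = w" "slot (prod_encode (w, i)) = i"
  by (simp_all add: satellite_def slot_def)

lemma edge_eqI: "satellite e = satellite e' \<Longrightarrow> slot e = slot e' \<Longrightarrow> e = e'"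
  unfolding satellite_def slot_def by (metis prod_decode_eq prod_eq_iff)

lemma slots_eq_image:
  "{e. satellite e \<in> W \<and> slot e \<in> I (satellite e)} = prod_encode ` Sigma W I"
proof (intro equalityI subsetI)
  fix e assume e: "e \<in> {e. satellite e \<in> W \<and> slot e \<in> I (satellite e)}"
  have "e = prod_encode (satellite e, slot e)" by (rule edge_eqI) simp_all
  then show "e \<in> prod_encode ` Sigma W I" using e by blast
qed auto

lemma card_slots:
  assumes "finite W" "\<And>w. w \<in> W \<Longrightarrow> finite (I w)"
  shows "card {e. satellite e \<in> W \<and> slot e \<in> I (satellite e)} = (\<Sum>w\<in>W. card (I w))"
    "finite {e. satellite e \<in> W \<and> slot e \<in> I (satellite e)}"
  unfolding slots_eq_image using assms
  by (simp_all add: card_image inj_on_def)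

text \<open>
  The satellite \<open>w\<close> has \<open>a w\<close> spokes, slot \<open>i\<close> leading to the hub \<open>c i\<close>, and its remaining slots are
  loops, as many as bring the degree up to \<open>2 * r + 1\<close> when \<open>a w\<close> is odd.
\<close>

definition hub_graph ::
    "nat \<Rightarrow> nat set \<Rightarrow> nat set \<Rightarrow> (nat \<Rightarrow> nat) \<Rightarrow> (nat \<Rightarrow> nat) \<Rightarrow> (nat, nat) mgraph" where
  "hub_graph r C W c a = \<lparr>
     verts = C \<union> W,
     edges = {e. satellite e \<in> W \<and> slot e < a (satellite e) + (2 * r + 1 - a (satellite e)) div 2},
     ends = (\<lambda>e. Upair (if slot e < a (satellite e) then c (slot e) else satellite e) (satellite e))\<rparr>"

locale hubs =
  fixes r :: nat and C W :: "nat set" and c a :: "nat \<Rightarrow> nat"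
  assumes fin: "finite C" "finite W" and disj: "C \<inter> W = {}"
    and a: "\<And>w. w \<in> W \<Longrightarrow> odd (a w) \<and> a w \<le> 2 * r + 1"
    and c: "\<And>w i. w \<in> W \<Longrightarrow> i < a w \<Longrightarrow> c i \<in> C"
    and hub_degree: "\<And>v. v \<in> C \<Longrightarrow> (\<Sum>w\<in>W. card {i. i < a w \<and> c i = v}) = 2 * r + 1"
begin

abbreviation "G \<equiv> hub_graph r C W c a"
abbreviation "n w \<equiv> a w + (2 * r + 1 - a w) div 2"

lemma edges_G: "edges G = {e. satellite e \<in> W \<and> slot e \<in> {..<n (satellite e)}}"
  by (simp add: hub_graph_def)

lemma ends_G: "ends G e = Upair (if slot e < a (satellite e) then c (slot e) else satellite e) (satellite e)"
  by (simp add: hub_graph_def)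

lemma finite_edges_G: "finite (edges G)"
  unfolding edges_G by (rule card_slots(2)) (simp_all add: fin)

lemma finite_G: "finite_multigraph G"
proof -
  have "set_uprod (ends G e) \<subseteq> verts G" if "e \<in> edges G" for e
    using that c by (auto simp: edges_G ends_G hub_graph_def)
  then show ?thesis
    using finite_edges_G fin by (simp add: finite_multigraph_def) (simp add: hub_graph_def fin)
qed

lemma satellite_in_W: "e \<in> edges G \<Longrightarrow> satellite e \<in> W \<and> satellite e \<notin> C"
  using disj by (auto simp: edges_G)

lemma hub_of_spoke:
  "e \<in> edges G \<Longrightarrow> slot e < a (satellite e) \<Longrightarrow> c (slot e) \<in> C \<and> c (slot e) \<notin> W"
  using c[of "satellite e" "slot e"] disj by (auto simp: edges_G)

lemma degree_satellite_sub:
  assumes "spanning_subgraph H G" "w \<in> W"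
  shows "degree H w = card {e \<in> edges H. satellite e = w \<and> slot e < a w} +
    2 * card {e \<in> edges H. satellite e = w \<and> \<not> slot e < a w}"
proof -
  have H: "e \<in> edges G" "ends H e = ends G e" if "e \<in> edges H" for e
    using that assms(1) by (auto simp: spanning_subgraph_def)
  have fH: "finite (edges H)" using assms(1) by (simp add: spanning_subgraph_def finite_multigraph_def)
  have "{e \<in> edges H. w \<in> set_uprod (ends H e)} = {e \<in> edges H. satellite e = w}"
    using H hub_of_spoke assms(2) by (auto simp: ends_G)
  moreover have "{e \<in> edges H. satellite e = w} =
      {e \<in> edges H. satellite e = w \<and> slot e < a w} \<union>
      {e \<in> edges H. satellite e = w \<and> \<not> slot e < a w}" by auto
  moreover have "card ({e \<in> edges H. satellite e = w \<and> slot e < a w} \<union>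
      {e \<in> edges H. satellite e = w \<and> \<not> slot e < a w}) =
      card {e \<in> edges H. satellite e = w \<and> slot e < a w} +
      card {e \<in> edges H. satellite e = w \<and> \<not> slot e < a w}"
    using fH by (intro card_Un_disjoint) auto
  ultimately have 1: "card {e \<in> edges H. w \<in> set_uprod (ends H e)} =
      card {e \<in> edges H. satellite e = w \<and> slot e < a w} +
      card {e \<in> edges H. satellite e = w \<and> \<not> slot e < a w}" by (simp only:)
  have "ends H e = Upair w w \<longleftrightarrow> satellite e = w \<and> \<not> slot e < a w" if "e \<in> edges H" for e
  proof (cases "slot e < a (satellite e)")
    case True
    then have "c (slot e) \<noteq> w" using hub_of_spoke[OF H(1)[OF that]] assms(2) by blast
    then show ?thesis using True unfolding H(2)[OF that] ends_G by auto
  next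
    case False
    then show ?thesis unfolding H(2)[OF that] ends_G by auto
  qed
  then have 2: "{e \<in> edges H. ends H e = Upair w w} =
      {e \<in> edges H. satellite e = w \<and> \<not> slot e < a w}" by blast
  show ?thesis unfolding degree_def 1 2 by simp
qed

lemma degree_hub_sub:
  assumes "spanning_subgraph H G" "v \<in> C"
  shows "degree H v = card {e \<in> edges H. slot e < a (satellite e) \<and> c (slot e) = v}"
proof -
  have H: "e \<in> edges G" "ends H e = ends G e" if "e \<in> edges H" for e
    using that assms(1) by (auto simp: spanning_subgraph_def)
  have ne: "satellite e \<noteq> v" if "e \<in> edges H" for e
    using satellite_in_W[OF H(1)[OF that]] assms(2) by auto
  have "v \<in> set_uprod (ends H e) \<longleftrightarrow> slot e < a (satellite e) \<and> c (slot e) = v"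
    if "e \<in> edges H" for e
    using ne[OF that] by (auto simp: H(2)[OF that] ends_G)
  then have "{e \<in> edges H. v \<in> set_uprod (ends H e)} =
      {e \<in> edges H. slot e < a (satellite e) \<and> c (slot e) = v}" by blast
  moreover have none: "{e \<in> edges H. ends H e = Upair v v} = {}"
    using ne H(2) by (auto simp: ends_G)
  ultimately show ?thesis by (simp only: degree_def none card.empty add_0_right)
qed

lemma spanning_G: "spanning_subgraph G G"
  using finite_G by (simp add: spanning_subgraph_def)

lemma regular_G: "regular_graph (2 * r + 1) G"
  unfolding regular_graph_def
proof
  fix v assume "v \<in> verts G"
  then consider "v \<in> W" | "v \<in> C" by (auto simp: hub_graph_def)
  then show "degree G v = 2 * r + 1"
  proof cases
    case 1
    have "{e \<in> edges G. satellite e = v \<and> slot e < a v} =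
        {e. satellite e \<in> {v} \<and> slot e \<in> {..<a v}}"
      using 1 by (auto simp: edges_G)
    then have "card {e \<in> edges G. satellite e = v \<and> slot e < a v} = a v"
      using card_slots(1)[of "{v}" "\<lambda>_. {..<a v}"] by simp
    moreover have "{e \<in> edges G. satellite e = v \<and> \<not> slot e < a v} =
        {e. satellite e \<in> {v} \<and> slot e \<in> {a v..<n v}}"
      using 1 by (auto simp: edges_G)
    then have "card {e \<in> edges G. satellite e = v \<and> \<not> slot e < a v} = (2 * r + 1 - a v) div 2"
      using card_slots(1)[of "{v}" "\<lambda>_. {a v..<n v}"] by simp
    moreover have "a v + 2 * ((2 * r + 1 - a v) div 2) = 2 * r + 1"
      using a[OF 1] by presburger
    ultimately show ?thesis using degree_satellite_sub[OF spanning_G 1] by simp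
  next
    case 2
    have "{e \<in> edges G. slot e < a (satellite e) \<and> c (slot e) = v} =
        {e. satellite e \<in> W \<and> slot e \<in> {i. i < a (satellite e) \<and> c i = v}}"
      by (auto simp: edges_G)
    then have "card {e \<in> edges G. slot e < a (satellite e) \<and> c (slot e) = v} = 2 * r + 1"
      using card_slots(1)[of W "\<lambda>w. {i. i < a w \<and> c i = v}"] fin hub_degree[OF 2] by simp
    then show ?thesis using degree_hub_sub[OF spanning_G 2] by simp
  qed
qed

text \<open>
  At a satellite the loops of a subgraph contribute an even amount, so an even factor uses an even
  number of its \<open>a w\<close> spokes, at most \<open>a w - 1\<close> as \<open>a w\<close> is odd.  All edges at hubs are
  spokes, hence the hubs cannot reach their degrees if these bounds sum to too little.
\<close>

lemma no_even_factor:
  assumes few: "(\<Sum>w\<in>W. a w - 1) < 2 * k * card C"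
  shows "\<not> has_factor (2 * k) G"
proof
  assume "has_factor (2 * k) G"
  then obtain H where H: "spanning_subgraph H G" and reg: "regular_graph (2 * k) H"
    unfolding has_factor_def is_factor_def by blast
  have deg: "degree H v = 2 * k" if "v \<in> C \<union> W" for v
    using reg H that by (auto simp: regular_graph_def spanning_subgraph_def hub_graph_def)
  have fH: "finite (edges H)" using H by (simp add: spanning_subgraph_def finite_multigraph_def)
  have HG: "edges H \<subseteq> edges G" using H by (simp add: spanning_subgraph_def)
  let ?spokes = "\<lambda>w. {e \<in> edges H. satellite e = w \<and> slot e < a w}"
  have "card (?spokes w) \<le> a w - 1" if w: "w \<in> W" for w
  proof -
    have "?spokes w \<subseteq> {e. satellite e \<in> {w} \<and> slot e \<in> {..<a w}}" by auto
    then have "card (?spokes w) \<le> card {e. satellite e \<in> {w} \<and> slot e \<in> {..<a w}}"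
      by (intro card_mono card_slots(2)) simp_all
    then have "card (?spokes w) \<le> a w"
      using card_slots(1)[of "{w}" "\<lambda>_. {..<a w}"] by simp
    moreover have "even (card (?spokes w))"
    proof -
      have "card (?spokes w) + 2 * card {e \<in> edges H. satellite e = w \<and> \<not> slot e < a w} = 2 * k"
        using deg[of w] degree_satellite_sub[OF H w] w by simp
      then show ?thesis by presburger
    qed
    ultimately show ?thesis using a[OF w] by (cases "card (?spokes w) = a w") auto
  qed
  then have "(\<Sum>w\<in>W. card (?spokes w)) < 2 * k * card C"
    using few by (meson le_less_trans sum_mono)
  moreover have "(\<Sum>w\<in>W. card (?spokes w)) = card (\<Union>w\<in>W. ?spokes w)"
    using fin fH by (intro card_UN_disjoint[symmetric]) auto
  moreover have "(\<Union>w\<in>W. ?spokes w) =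
      (\<Union>v\<in>C. {e \<in> edges H. slot e < a (satellite e) \<and> c (slot e) = v})"
    using HG c by (auto simp: edges_G)
  moreover have "card (\<Union>v\<in>C. {e \<in> edges H. slot e < a (satellite e) \<and> c (slot e) = v}) =
      (\<Sum>v\<in>C. card {e \<in> edges H. slot e < a (satellite e) \<and> c (slot e) = v})"
    using fin fH by (intro card_UN_disjoint) auto
  moreover have "\<dots> = (\<Sum>v\<in>C. 2 * k)"
    using degree_hub_sub[OF H] deg by (intro sum.cong) auto
  ultimately show False by simp
qed

lemma loop_not_cut_edge:
  assumes "e \<in> edges G" "\<not> slot e < a (satellite e)"
  shows "e \<notin> cut_edges G"
  using assms cut_edge_iff[OF finite_G assms(1), of "satellite e" "satellite e"] by (simp add: ends_G)

end

lemma adj_relI: "e \<in> edges G \<Longrightarrow> ends G e = Upair u v \<Longrightarrow> (u, v) \<in> adj_rel G"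
  by (auto simp: adj_rel_def)

text \<open>
  One hub with \<open>2 * r + 4 - 3 * k\<close> satellites on a single spoke, which is a cut-edge, and \<open>k - 1\<close>
  satellites on three spokes.  An even factor uses none of the single spokes and at most two of
  each three, so the hub gets degree at most \<open>2 * (k - 1)\<close>.
\<close>

lemma sharp_cut_edge_bound:
  assumes k: "0 < k" "3 * k \<le> 2 * r + 1"
  shows "\<exists>G :: (nat, nat) mgraph. finite_multigraph G \<and> regular_graph (2 * r + 1) G \<and>
    card (cut_edges G) = 2 * r + 4 - 3 * k \<and> \<not> has_factor (2 * k) G"
proof -
  define p where "p = 2 * r + 4 - 3 * k"
  define W where "W = {1..p + (k - 1)}"
  define a :: "nat \<Rightarrow> nat" where "a w = (if w \<le> p then 1 else 3)" for w
  have p: "p + 3 * (k - 1) = 2 * r + 1" using k by (simp add: p_def)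
  have split: "(\<Sum>w\<in>W. f (a w)) = p * f 1 + (k - 1) * f 3" for f :: "nat \<Rightarrow> nat"
  proof -
    have "W = {1..p} \<union> {p + 1..p + (k - 1)}" by (auto simp: W_def)
    then have "(\<Sum>w\<in>W. f (a w)) = (\<Sum>w\<in>{1..p}. f (a w)) + (\<Sum>w\<in>{p + 1..p + (k - 1)}. f (a w))"
      by (simp only:, intro sum.union_disjoint) auto
    also have "(\<Sum>w\<in>{1..p}. f (a w)) = (\<Sum>w\<in>{1..p}. f 1)" by (intro sum.cong) (auto simp: a_def)
    also have "(\<Sum>w\<in>{p + 1..p + (k - 1)}. f (a w)) = (\<Sum>w\<in>{p + 1..p + (k - 1)}. f 3)"
      by (intro sum.cong) (auto simp: a_def)
    finally show ?thesis by simp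
  qed
  have ar: "a w \<le> 2 * r + 1" if "w \<in> W" for w
    using that p by (cases "k = 1") (auto simp: a_def W_def)
  interpret hubs r "{0}" W "\<lambda>_. 0" a
  proof
    show "(\<Sum>w\<in>W. card {i. i < a w \<and> 0 = v}) = 2 * r + 1" if "v \<in> {0}" for v
      using that split[of "\<lambda>x. card {i. i < x}"] p by simp
  qed (use ar in \<open>auto simp: W_def a_def\<close>)
  have "(\<Sum>w\<in>W. a w - 1) < 2 * k * card {0::nat}" using split[of "\<lambda>x. x - 1"] k by simp
  then have no: "\<not> has_factor (2 * k) G" by (rule no_even_factor)
  have "cut_edges G = {e. satellite e \<in> {1..p} \<and> slot e \<in> {0}}"
  proof (intro equalityI subsetI)
    fix e assume cut: "e \<in> cut_edges G"
    then have e: "e \<in> edges G" by (simp add: cut_edges_def)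
    let ?w = "satellite e"
    have spoke: "slot e < a ?w" using loop_not_cut_edge[OF e] cut by blast
    have w: "?w \<in> W" using e by (simp add: edges_G)
    show "e \<in> {e. satellite e \<in> {1..p} \<and> slot e \<in> {0}}"
    proof (cases "?w \<le> p")
      case True
      then show ?thesis using spoke w by (simp add: a_def W_def)
    next
      case False
      then have a3: "a ?w = 3" by (simp add: a_def)
      define e' where "e' = prod_encode (?w, if slot e = 0 then 1 else 0)"
      have "slot e' \<noteq> slot e" by (simp add: e'_def)
      then have "e' \<noteq> e" by auto
      then have "e' \<in> edges (delete_edge G e)"
        using w a3 by (simp add: e'_def delete_edge_def edges_G)
      moreover have "ends (delete_edge G e) e' = Upair 0 ?w"
        using a3 by (simp add: e'_def delete_edge_def ends_G)
      ultimately have "(0, ?w) \<in> adj_rel (delete_edge G e)" by (rule adj_relI)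
      moreover have "ends G e = Upair 0 ?w" using spoke by (simp add: ends_G)
      ultimately show ?thesis using cut cut_edge_iff[OF finite_G e] by blast
    qed
  next
    fix e assume "e \<in> {e. satellite e \<in> {1..p} \<and> slot e \<in> {0}}"
    then have e: "satellite e \<in> {1..p}" "slot e = 0" by auto
    let ?w = "satellite e"
    have a1: "a ?w = 1" and w: "?w \<in> W" using e by (auto simp: a_def W_def)
    show "e \<in> cut_edges G"
    proof (rule cut_edgeI[OF finite_G, of _ ?w 0 "{?w}"])
      show "e \<in> edges G" using a1 w e by (simp add: edges_G)
      show "ends G e = Upair ?w 0" using a1 e by (simp add: ends_G)
      show "0 \<notin> {?w}" using e by simp
      fix e' x y assume e': "e' \<in> edges G - {e}" "ends G e' = Upair x y" "x \<in> {?w}"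
      have "satellite e' = ?w"
        using e' e(1) by (auto simp: ends_G split: if_splits)
      then have "\<not> slot e' < a (satellite e')"
        using e'(1) a1 e(2) edge_eqI[of e' e] by auto
      then show "y \<in> {?w}" using e'(2,3) by (auto simp: ends_G)
    qed simp
  qed
  then have "card (cut_edges G) = p"
    using card_slots(1)[of "{1..p}" "\<lambda>_. {0}"] by simp
  then show ?thesis using finite_G regular_G no unfolding p_def by blast
qed

text \<open>
  Three hubs, each joined by one spoke to each of \<open>2 * r + 1\<close> satellites.  An even factor uses at
  most two spokes per satellite, \<open>4 * r + 2\<close> altogether, while the three hubs need \<open>6 * k\<close>.  A
  complete bipartite graph with at least two vertices on each side has no cut-edge: the ends of
  a deleted spoke are still joined by a path of length three.
\<close>

lemma sharp_factor_bound:
  assumes r: "0 < r" and k: "2 * r + 1 < 3 * k"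
  shows "\<exists>G :: (nat, nat) mgraph. finite_multigraph G \<and> regular_graph (2 * r + 1) G \<and>
    cut_edges G = {} \<and> \<not> has_factor (2 * k) G"
proof -
  define W where "W = {3..<2 * r + 4}"
  define a :: "nat \<Rightarrow> nat" where "a w = 3" for w
  interpret hubs r "{..<3}" W "\<lambda>i. i" a
  proof
    show "(\<Sum>w\<in>W. card {i. i < a w \<and> i = v}) = 2 * r + 1" if "v \<in> {..<3}" for v
    proof -
      have "{i. i < a w \<and> i = v} = {v}" for w using that by (auto simp: a_def)
      then show ?thesis by (simp add: W_def)
    qed
  qed (use r in \<open>auto simp: W_def a_def\<close>)
  have "(\<Sum>w\<in>W. a w - 1) < 2 * k * card {..<3::nat}" using k by (simp add: W_def a_def)
  then have no: "\<not> has_factor (2 * k) G" by (rule no_even_factor)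
  have "e \<notin> cut_edges G" for e
  proof
    assume cut: "e \<in> cut_edges G"
    then have e: "e \<in> edges G" by (simp add: cut_edges_def)
    let ?w = "satellite e" and ?i = "slot e" and ?G' = "delete_edge G e"
    have i: "?i < 3" using loop_not_cut_edge[OF e] cut by (auto simp: a_def)
    have w: "?w \<in> W" using e by (simp add: edges_G)
    have adj: "(j, w) \<in> adj_rel ?G'" if "w \<in> W" "j < 3" "w \<noteq> ?w \<or> j \<noteq> ?i" for w j
    proof (rule adj_relI)
      show "prod_encode (w, j) \<in> edges ?G'"
        using that by (auto simp: delete_edge_def edges_G a_def)
      show "ends ?G' (prod_encode (w, j)) = Upair j w"
        using that by (simp add: delete_edge_def ends_G a_def)
    qed
    have adj': "(w, j) \<in> adj_rel ?G'" if "w \<in> W" "j < 3" "w \<noteq> ?w \<or> j \<noteq> ?i" for w j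
      using adj[OF that] adj_rel_sym[of ?G'] by (auto simp: sym_def)
    define j where "j = (if ?i = 0 then 1 else 0 :: nat)"
    define w' where "w' = (if ?w = 3 then 4 else 3 :: nat)"
    have j: "j < 3" "j \<noteq> ?i" by (auto simp: j_def)
    have w': "w' \<in> W" "w' \<noteq> ?w" using r by (auto simp: w'_def W_def)
    have "(?i, w') \<in> adj_rel ?G'" "(w', j) \<in> adj_rel ?G'" "(j, ?w) \<in> adj_rel ?G'"
      using adj[of w' ?i] adj'[of w' j] adj[of ?w j] i w j w' by auto
    then have "(?i, ?w) \<in> (adj_rel ?G')\<^sup>*" by (meson converse_rtrancl_into_rtrancl rtrancl.rtrancl_refl)
    moreover have "ends G e = Upair ?i ?w" using i by (simp add: ends_G a_def)
    ultimately show False using cut cut_edge_iff[OF finite_G e] by blast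
  qed
  then show ?thesis using finite_G regular_G no by blast
qed

section \<open>The bounds and their sharpness\<close>

theorem theorem1p2:
  shows
  "(\<forall>r k :: nat. 0 < r \<and> 0 < k \<and> real k \<le> (2 * real r + 1) / 3 \<longrightarrow>
      (\<forall>G :: ('v, 'e) mgraph.
         finite_multigraph G \<and> regular_graph (2 * r + 1) G \<and>
         int (card (cut_edges G)) \<le> 2 * int r - 3 * (int k - 1) \<longrightarrow>
         has_factor (2 * k) G))
   \<and>
   (\<forall>r k :: nat. 0 < r \<and> 0 < k \<and> real k \<le> (2 * real r + 1) / 3 \<longrightarrow>
      (\<exists>G :: (nat, nat) mgraph.
         finite_multigraph G \<and> regular_graph (2 * r + 1) G \<and>
         int (card (cut_edges G)) = 2 * int r - 3 * (int k - 1) + 1 \<and>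
         \<not> has_factor (2 * k) G))
   \<and>
   (\<forall>r k :: nat. 0 < r \<and> 0 < k \<and> real k > (2 * real r + 1) / 3 \<longrightarrow>
      (\<exists>G :: (nat, nat) mgraph.
         finite_multigraph G \<and> regular_graph (2 * r + 1) G \<and>
         cut_edges G = {} \<and>
         \<not> has_factor (2 * k) G))"
proof (intro conjI allI impI)
  fix r k :: nat and G :: "('v, 'e) mgraph"
  assume rk: "0 < r \<and> 0 < k \<and> real k \<le> (2 * real r + 1) / 3"
    and G: "finite_multigraph G \<and> regular_graph (2 * r + 1) G \<and>
      int (card (cut_edges G)) \<le> 2 * int r - 3 * (int k - 1)"
  have "real (3 * k) \<le> real (2 * r + 1)" using rk by simp
  then have "3 * k \<le> 2 * r + 1" by (simp only: of_nat_le_iff)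
  moreover have "int (card (cut_edges G)) \<le> 2 * int r - 3 * (int k - 1)" using G by blast
  then have "int (card (cut_edges G) + 3 * k) \<le> int (2 * r + 3)" by simp
  then have "card (cut_edges G) + 3 * k \<le> 2 * r + 3" by (simp only: of_nat_le_iff)
  ultimately show "has_factor (2 * k) G"
    using rk G regular_graph_has_even_factor[of G r k] by blast
next
  fix r k :: nat
  assume rk: "0 < r \<and> 0 < k \<and> real k \<le> (2 * real r + 1) / 3"
  then have "real (3 * k) \<le> real (2 * r + 1)" by simp
  then have le: "3 * k \<le> 2 * r + 1" by (simp only: of_nat_le_iff)
  have "int (2 * r + 4 - 3 * k) = 2 * int r - 3 * (int k - 1) + 1" using le by (simp add: of_nat_diff)
  moreover obtain G :: "(nat, nat) mgraph" where "finite_multigraph G"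
    "regular_graph (2 * r + 1) G" "card (cut_edges G) = 2 * r + 4 - 3 * k" "\<not> has_factor (2 * k) G"
    using sharp_cut_edge_bound[OF _ le] rk by blast
  ultimately show "\<exists>G :: (nat, nat) mgraph. finite_multigraph G \<and> regular_graph (2 * r + 1) G \<and>
      int (card (cut_edges G)) = 2 * int r - 3 * (int k - 1) + 1 \<and> \<not> has_factor (2 * k) G"
    by (intro exI[of _ G]) simp
next
  fix r k :: nat
  assume rk: "0 < r \<and> 0 < k \<and> real k > (2 * real r + 1) / 3"
  then have "real (2 * r + 1) < real (3 * k)" by simp
  then have "2 * r + 1 < 3 * k" by (simp only: of_nat_less_iff)
  with rk show "\<exists>G :: (nat, nat) mgraph. finite_multigraph G \<and> regular_graph (2 * r + 1) G \<and>
      cut_edges G = {} \<and> \<not> has_factor (2 * k) G"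
    by (intro sharp_factor_bound) simp_all
qed

end
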